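(* For $m\ge2$ let $X_m$ be a random variable with the $\mathrm{PF\text{-}CME}_m$ density $f_m$, and let $n_m:=2r_m(m-1)+1$. Then $\log^3 n_m/n_m^2=o(1/n_m)$ as $m\to\infty$, and $\mathrm{PF\text{-}CME}$ asymptotically surpasses the Erlang bound, that is, $\mathrm{SCV}(X_m)<1/n_m$ for all sufficiently large $m$. Moreover, the two sequences $$\frac{m^2}{\log m}\,\mathrm{SCV}(X_m)\qquad\text{and}\qquad \frac{n_m^2}{\log^3 n_m}\,\mathrm{SCV}(X_m),\qquad m\ge2,$$ stay bounded away from $0$ and $\infty$.
   Context: $\log$ is the natural logarithm and $\log^3 n=(\log n)^3$. For an integer $m\ge2$, the Fejér kernel of order $m$ is $$\Phi_m(\theta)=1+2\sum_{\ell=1}^{m-1}\left(1-\frac{\ell}{m}\right)\cos(\ell\theta)=\frac1m\left(\frac{\sin(m\theta/2)}{\sin(\theta/2)}\right)^2,$$ the last expression being understood by continuity at multiples of $2\pi$. Set $$r_m:=\lceil\log m\rceil,\quad h_m:=2\log m+\log\log m,\quad \omega_m:=\frac{2\pi}{h_m},\quad W_m(\theta):=(\Phi_m(\theta))^{r_m}.$$ The powered-Fejér concentrated matrix-exponential density of index $m$ ($\mathrm{PF\text{-}CME}_m$) is $$f_m(t)=C_m\,e^{-t}\,W_m(\omega_m(t-1)),\qquad t\ge0,$$ where $C_m>0$ is the normalizing constant making $\int_0^\infty f_m(t)\,dt=1$. The squared coefficient of variation is $\mathrm{SCV}(X)=\operatorname{Var}(X)/\mathbb{E}[X]^2$. The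 integer $n_m$ is the minimal matrix-exponential order of $f_m$ (the degree of its rational Laplace transform). The Erlang bound at order $n$ is $1/n$, the SCV of the Erlang law of order $n$, which is the least SCV among phase-type laws of order $n$. $f(m)=o(g(m))$ means $f(m)/g(m)\to0$ as $m\to\infty$. *)

theory Defs
  imports "HOL-Probability.Probability"
begin

definition fejer :: "nat \<Rightarrow> real \<Rightarrow> real" where
  "fejer m \<theta> = 1 + 2 * (\<Sum>l=1..m-1. (1 - real l / real m) * cos (real l * \<theta>))"

definition pf_r :: "nat \<Rightarrow> nat" where
  "pf_r m = nat \<lceil>ln (real m)\<rceil>"

definition pf_h :: "nat \<Rightarrow> real" where
  "pf_h m = 2 * ln (real m) + ln (ln (real m))"

definition pf_omega :: "nat \<Rightarrow> real" where
  "pf_omega m = 2 * pi / pf_h m"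

definition pf_W :: "nat \<Rightarrow> real \<Rightarrow> real" where
  "pf_W m \<theta> = fejer m \<theta> ^ pf_r m"

definition pf_C :: "nat \<Rightarrow> real" where
  "pf_C m = 1 / (LBINT t:{0..}. exp (- t) * pf_W m (pf_omega m * (t - 1)))"

definition pf_cme_density :: "nat \<Rightarrow> real \<Rightarrow> real" where
  "pf_cme_density m t =
     (if t \<ge> 0 then pf_C m * exp (- t) * pf_W m (pf_omega m * (t - 1)) else 0)"

(* The order of the density as a matrix-exponential law: exp (- t) times a trigonometric
   polynomial of degree pf_r m * (m - 1). *)
definition pf_n :: "nat \<Rightarrow> nat" where
  "pf_n m = 2 * pf_r m * (m - 1) + 1"

definition SCV :: "'a measure \<Rightarrow> ('a \<Rightarrow> real) \<Rightarrow> real" where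
  "SCV M X = prob_space.variance M X / (prob_space.expectation M X)\<^sup>2"

lemma fejer_aux:
  fixes x :: real
  shows "(sin (x/2))\<^sup>2 * (real m + 2 * (\<Sum>l=1..<m. (real m - real l) * cos (real l * x)))
          = (sin (real m * x / 2))\<^sup>2"
proof (induction m)
  case 0
  show ?case by simp
next
  case (Suc m)
  have D: "sin (x/2) * (1 + 2 * (\<Sum>l=1..<Suc k. cos (real l * x))) = sin ((real k + 1/2) * x)" for k
  proof (induction k)
    case 0
    show ?case by simp
  next
    case (Suc k)
    have e: "2 * sin (x/2) * cos (real (Suc k) * x)
        = sin ((real (Suc k) + 1/2) * x) - sin ((real k + 1/2) * x)"
    proof -
      have "(real (Suc k) + 1/2) * x = real (Suc k) * x + x/2" "(real k + 1/2) * x = real (Suc k) * x - x/2"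
        by (simp_all add: algebra_simps add_divide_distrib)
      then show ?thesis by (simp only: sin_add sin_diff) simp
    qed
    have "(\<Sum>l=1..<Suc (Suc k). cos (real l * x)) = (\<Sum>l=1..<Suc k. cos (real l * x)) + cos (real (Suc k) * x)"
      by (subst sum.atLeastLessThan_Suc) auto
    then show ?case using Suc e by (simp add: distrib_left del: of_nat_Suc)
  qed
  have s: "(\<Sum>l=1..<Suc m. (real (Suc m) - real l) * cos (real l * x))
      = (\<Sum>l=1..<m. (real m - real l) * cos (real l * x)) + (\<Sum>l=1..<Suc m. cos (real l * x))"
  proof -
    have "(\<Sum>l=1..<Suc m. (real (Suc m) - real l) * cos (real l * x))
      = (\<Sum>l=1..<Suc m. (real m - real l) * cos (real l * x)) + (\<Sum>l=1..<Suc m. cos (real l * x))"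
      by (simp add: sum.distrib[symmetric] algebra_simps)
    moreover have "(\<Sum>l=1..<Suc m. (real m - real l) * cos (real l * x)) = (\<Sum>l=1..<m. (real m - real l) * cos (real l * x))"
      by (cases "m = 0") (auto simp: sum.atLeastLessThan_Suc)
    ultimately show ?thesis by simp
  qed
  have p: "sin (x/2) * sin ((real m + 1/2) * x) = (sin (real (Suc m) * x / 2))\<^sup>2 - (sin (real m * x / 2))\<^sup>2"
  proof -
    define a where "a = real m * x / 2"
    define b where "b = x / 2"
    have 1: "real (Suc m) * x / 2 = a + b" "(real m + 1/2) * x = a + (a + b)"
      by (simp_all add: a_def b_def field_simps)
    have "sin b * (sin a * cos (a+b) + cos a * sin (a+b)) = (sin (a+b))\<^sup>2 - (sin a)\<^sup>2"
      unfolding sin_add cos_add using sin_cos_squared_add[of a] sin_cos_squared_add[of b] by algebra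
    then show ?thesis
      unfolding 1 sin_add[of a "a + b"] by (simp only: a_def b_def)
  qed
  have "(sin (x/2))\<^sup>2 * (real (Suc m) + 2 * (\<Sum>l=1..<Suc m. (real (Suc m) - real l) * cos (real l * x)))
     = (sin (x/2))\<^sup>2 * (real m + 2 * (\<Sum>l=1..<m. (real m - real l) * cos (real l * x)))
       + sin (x/2) * (sin (x/2) * (1 + 2 * (\<Sum>l=1..<Suc m. cos (real l * x))))"
    unfolding s by (simp add: algebra_simps power2_eq_square)
  also have "\<dots> = (sin (real (Suc m) * x / 2))\<^sup>2"
    unfolding Suc D p by simp
  finally show ?case .
qed

lemma fejer_mult:
  assumes "m \<ge> 2"
  shows "real m * fejer m x = real m + 2 * (\<Sum>l=1..<m. (real m - real l) * cos (real l * x))"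
proof -
  have i: "{1..m-1} = {1..<m}" using assms by auto
  have "real m * (\<Sum>l=1..<m. (1 - real l / real m) * cos (real l * x))
    = (\<Sum>l=1..<m. (real m - real l) * cos (real l * x))"
    unfolding sum_distrib_left using assms by (intro sum.cong) (auto simp: field_simps)
  then show ?thesis unfolding fejer_def i by (simp add: distrib_left)
qed

lemma fejer_closed_form:
  assumes "m \<ge> 2" "sin (x/2) \<noteq> 0"
  shows "fejer m x = (1 / real m) * (sin (real m * x / 2) / sin (x / 2))\<^sup>2"
  using fejer_aux[of x m] assms unfolding fejer_mult[OF assms(1), symmetric]
  by (simp add: field_simps power2_eq_square)

lemma fejer_at_period:
  assumes "m \<ge> 2" "sin (x/2) = 0"
  shows "fejer m x = real m"
proof -
  obtain i :: int where "x / 2 = of_int i * pi"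
    using assms(2) by (auto simp: sin_zero_iff_int2)
  then have x: "x = of_int i * (2 * pi)" by simp
  have "cos (real l * x) = 1" for l
  proof -
    have "real l * x = 2 * pi * of_int (int l * i)" using x by (simp add: mult_ac)
    then show ?thesis by (simp only: cos_int_2pin)
  qed
  then have "real m * fejer m x = real m + 2 * (\<Sum>l=1..<m. (real m - real l))"
    using fejer_mult[OF assms(1)] by simp
  also have "\<dots> = real m * real m"
  proof -
    have "2 * (\<Sum>l=1..<k. real l) = real k * (real k - 1)" for k
      by (induction k) (simp_all add: algebra_simps)
    then show ?thesis using assms by (simp add: sum_subtractf algebra_simps of_nat_diff)
  qed
  finally show ?thesis using assms by simp
qed

lemma fejer_nonneg: "m \<ge> 2 \<Longrightarrow> fejer m x \<ge> 0"
  by (cases "sin (x/2) = 0") (simp_all add: fejer_closed_form fejer_at_period)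

lemma continuous_pf_W: "continuous_on A (\<lambda>t. exp (- t) * pf_W m (pf_omega m * (t - 1)))"
  unfolding pf_W_def fejer_def by (intro continuous_intros)

lemma set_integrable_pf_W:
  "set_integrable lborel {0..} (\<lambda>t. exp (- t) * pf_W m (pf_omega m * (t - 1)))"
proof -
  define B where "B = (1 + 2 * (\<Sum>l=1..m-1. \<bar>1 - real l / real m\<bar>)) ^ pf_r m"
  have "\<bar>fejer m x\<bar> \<le> 1 + 2 * (\<Sum>l=1..m-1. \<bar>1 - real l / real m\<bar>)" for x
  proof -
    have "\<bar>\<Sum>l=1..m-1. (1 - real l / real m) * cos (real l * x)\<bar> \<le> (\<Sum>l=1..m-1. \<bar>1 - real l / real m\<bar>)"
      by (intro order.trans[OF sum_abs] sum_mono) (simp add: abs_mult mult_left_le)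
    then show ?thesis unfolding fejer_def by linarith
  qed
  then have B: "\<bar>pf_W m x\<bar> \<le> B" for x
    unfolding pf_W_def B_def power_abs by (intro power_mono) auto
  have "(\<lambda>t::real. exp (- 1 * t)) absolutely_integrable_on {0..}"
    by (intro nonnegative_absolutely_integrable_1 integrable_on_exp_minus_to_infinity) auto
  then have e: "set_integrable lborel {0..} (\<lambda>t::real. exp (- t))"
    unfolding set_integrable_def by (subst (asm) integrable_completion) auto
  have "set_integrable lborel {0..} (\<lambda>t. B * exp (- t))"
    by (intro set_integrable_mult_right e)
  then show ?thesis
  proof (rule set_integrable_bound)
    show "set_borel_measurable lborel {0..} (\<lambda>t. exp (- t) * pf_W m (pf_omega m * (t - 1)))"
      unfolding set_borel_measurable_def
      using borel_measurable_continuous_onI[OF continuous_pf_W[of UNIV m]] by simp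
    show "AE t in lborel. t \<in> {0..} \<longrightarrow>
        norm (exp (- t) * pf_W m (pf_omega m * (t - 1))) \<le> norm (B * exp (- t))"
    proof (intro AE_I2 impI)
      fix t :: real
      show "norm (exp (- t) * pf_W m (pf_omega m * (t - 1))) \<le> norm (B * exp (- t))"
        using order.trans[OF B abs_ge_self, of "pf_omega m * (t - 1)"]
        by (simp add: abs_mult mult.commute)
    qed
  qed
qed

lemma pf_C_pos:
  assumes "m \<ge> 2"
  shows "pf_C m > 0"
proof -
  let ?g = "\<lambda>t. exp (- t) * pf_W m (pf_omega m * (t - 1))"
  have nn: "?g t \<ge> 0" for t
    using fejer_nonneg[OF assms] by (simp add: pf_W_def)
  have s: "set_integrable lborel {0..2} ?g"
    by (rule set_integrable_subset[OF set_integrable_pf_W]) auto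
  have le: "(LBINT t:{0..2}. ?g t) \<le> (LBINT t:{0..}. ?g t)"
    unfolding set_lebesgue_integral_def
  proof (rule integral_mono)
    show "integrable lborel (\<lambda>t. indicat_real {0..2} t *\<^sub>R ?g t)"
      using s by (simp only: set_integrable_def)
    show "integrable lborel (\<lambda>t. indicat_real {0..} t *\<^sub>R ?g t)"
      using set_integrable_pf_W[of m] by (simp only: set_integrable_def)
    show "indicat_real {0..2} t *\<^sub>R ?g t \<le> indicat_real {0..} t *\<^sub>R ?g t" for t
      using nn[of t] by (cases "t \<in> {0..2}") (auto simp: indicator_def zero_le_mult_iff)
  qed
  have "(LBINT t:{0..2}. ?g t) \<noteq> 0"
  proof
    assume z: "(LBINT t:{0..2}. ?g t) = 0"
    have "(?g has_integral 0) (cbox 0 2)"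
      using has_integral_set_lebesgue[of "{0..2}" ?g] set_borel_integral_eq_integral[OF s] z
      by (simp add: has_integral_iff)
    then have "?g 1 = 0"
      by (rule has_integral_0_cbox_imp_0[OF continuous_pf_W, rotated -3]) (use nn in auto)
    then show False using fejer_at_period[OF assms, of 0] assms by (simp add: pf_W_def)
  qed
  moreover have "(LBINT t:{0..2}. ?g t) \<ge> 0"
    using nn by (simp add: set_lebesgue_integral_def)
  ultimately show ?thesis using le by (simp add: pf_C_def)
qed

lemma pf_cme_density_nonneg: "m \<ge> 2 \<Longrightarrow> pf_cme_density m t \<ge> 0"
  using pf_C_pos[of m] fejer_nonneg[of m] by (simp add: pf_cme_density_def pf_W_def)

lemma prob_space_pf_cme_density:
  assumes "m \<ge> 2"
  shows "prob_space (density lborel (\<lambda>t. ennreal (pf_cme_density m t)))"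
proof (rule prob_spaceI)
  let ?g = "\<lambda>t. exp (- t) * pf_W m (pf_omega m * (t - 1))"
  have eq: "pf_cme_density m = (\<lambda>t. pf_C m * (indicat_real {0..} t *\<^sub>R ?g t))"
    by (auto simp: fun_eq_iff pf_cme_density_def indicator_def)
  have int: "integrable lborel (pf_cme_density m)"
    unfolding eq using set_integrable_pf_W[of m]
    by (intro integrable_mult_right) (simp only: set_integrable_def)
  have "integral\<^sup>L lborel (pf_cme_density m) = pf_C m * (LBINT t:{0..}. ?g t)"
    unfolding eq set_lebesgue_integral_def by (rule integral_mult_right_zero)
  also have "\<dots> = 1"
    using pf_C_pos[OF assms] by (simp add: pf_C_def)
  finally have "(\<integral>\<^sup>+t. ennreal (pf_cme_density m t) \<partial>lborel) = 1"
    using nn_integral_eq_integral[OF int] pf_cme_density_nonneg[OF assms] by simp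
  then show "emeasure (density lborel (\<lambda>t. ennreal (pf_cme_density m t)))
      (space (density lborel (\<lambda>t. ennreal (pf_cme_density m t)))) = 1"
    using int by (simp add: emeasure_density)
qed

end

theory Submission
  imports Defs "HOL-Real_Asymp.Real_Asymp"
begin

text \<open>
  Write \<open>L = ln m\<close>. The normalised weight \<open>w u = (fejer m (\<omega> u) / m) ^ r\<close> takes values in \<open>[0, 1]\<close>, has
  period \<open>h\<close>, and near \<open>u = 0\<close> is a peak of width of order \<open>sqrt L / m\<close>, so the mass
  \<open>N\<close> of \<open>exp (- t) * w (t - 1)\<close> is at least of that order. The density is at most \<open>1 / N\<close>, and a bounded
  density cannot concentrate: the variance is at least \<open>N\<^sup>2 / 32\<close>, of order \<open>L / m\<^sup>2\<close>.

  Conversely the variance is at most the second moment about \<open>1\<close>. On one period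
  \<open>w u \<le> 1 / (1 + b u\<^sup>2)\<^sup>3\<close> with \<open>b\<close> of order \<open>m\<^sup>2 / L\<close>, which gives a contribution of order
  \<open>L / m\<^sup>2\<close> relative to \<open>N\<close>; the later periods cost a factor \<open>h\<^sup>2 exp (- h)\<close>, and the choice of \<open>h\<close>
  makes this of order \<open>L / m\<^sup>2\<close> as well.
\<close>

subsection \<open>The Fejer kernel\<close>

text \<open>At \<open>x = 0\<close> the kernel attains \<open>m\<close>, and subtracting that case
  leaves the loss from the maximum as a nonnegative combination of terms \<open>1 - cos\<close>.
  Bounds on a single cosine then transfer termwise to the kernel.\<close>

lemma fejer_deficit:
  assumes "m \<ge> 2"
  shows "real m * fejer m x = real m ^ 2 - 2 * (\<Sum>l=1..<m. (real m - real l) * (1 - cos (real l * x)))"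
proof -
  have "real m ^ 2 = real m + 2 * (\<Sum>l=1..<m. (real m - real l))"
    using fejer_mult[OF assms, of 0] fejer_at_period[OF assms, of 0] by (simp add: power2_eq_square)
  then show ?thesis
    unfolding fejer_mult[OF assms] by (simp add: right_diff_distrib sum_subtractf)
qed

text \<open>This sum is the coefficient produced by the quadratic part of every
  \<open>1 - cos\<close> in the deficit.\<close>

lemma sum_weighted_squares:
  "12 * (\<Sum>l=1..<m. (real m - real l) * real l ^ 2) = real m ^ 2 * (real m ^ 2 - 1)"
proof -
  \<comment> \<open>The coefficient \<open>c\<close> is kept separate from the upper limit
    \<open>k\<close>; otherwise every summand would change in the induction step.\<close>
  have "12 * (\<Sum>l=1..<k. (c - real l) * real l ^ 2)
      = 2 * c * (real k - 1) * real k * (2 * real k - 1) - 3 * (real k * (real k - 1)) ^ 2" for k c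
    by (induction k) (auto simp: algebra_simps power2_eq_square)
  from this[of "real m" m] show ?thesis
    by (simp add: algebra_simps power2_eq_square)
qed

lemma cos_le_quartic: "cos (x::real) \<le> 1 - x ^ 2 / 2 + x ^ 4 / 24"
proof -
  obtain t where t: "cos x = (\<Sum>k<4. cos_coeff k * x ^ k) + (cos (t + 1/2 * real 4 * pi) / fact 4) * x ^ 4"
    using Maclaurin_cos_expansion[of x 4] by blast
  have "cos (t + 1/2 * real 4 * pi) / fact 4 * x ^ 4 \<le> 1 / fact 4 * x ^ 4"
    by (intro mult_right_mono divide_right_mono) auto
  moreover have "(\<Sum>k<4. f k) = f 0 + f 1 + f 2 + f 3" for f :: "nat \<Rightarrow> real"
    by (simp add: eval_nat_numeral)
  ultimately show ?thesis
    unfolding t by (simp add: cos_coeff_def fact_numeral)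
qed

lemma cos_ge_quadratic: "cos (x::real) \<ge> 1 - x ^ 2 / 2"
proof -
  obtain t where t: "cos x = (\<Sum>k<2. cos_coeff k * x ^ k) + (cos (t + 1/2 * real 2 * pi) / fact 2) * x ^ 2"
    using Maclaurin_cos_expansion[of x 2] by blast
  have "cos (t + 1/2 * real 2 * pi) / fact 2 * x ^ 2 \<ge> (-1) / fact 2 * x ^ 2"
    by (intro mult_right_mono divide_right_mono) auto
  then show ?thesis
    unfolding t by (simp add: cos_coeff_def eval_nat_numeral)
qed

text \<open>Each \<open>1 - cos y\<close> in the deficit is at most \<open>y ^ 2 / 2\<close>, and
  \<open>sum_weighted_squares\<close> evaluates the resulting sum. This lower bound feeds the lower
  bound on the mass.\<close>

lemma fejer_ge:
  assumes "m \<ge> 2"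
  shows "fejer m x / real m \<ge> 1 - (real m * x) ^ 2 / 12"
proof -
  have "(\<Sum>l=1..<m. (real m - real l) * (1 - cos (real l * x)))
      \<le> (\<Sum>l=1..<m. (real m - real l) * ((real l * x) ^ 2 / 2))"
  proof (intro sum_mono mult_left_mono)
    fix l assume "l \<in> {1..<m}"
    then show "0 \<le> real m - real l" by auto
    show "1 - cos (real l * x) \<le> (real l * x) ^ 2 / 2"
      using cos_ge_quadratic[of "real l * x"] by simp
  qed
  also have "\<dots> = x ^ 2 / 2 * (\<Sum>l=1..<m. (real m - real l) * real l ^ 2)"
    unfolding sum_distrib_left by (intro sum.cong) (auto simp: power_mult_distrib)
  also have "\<dots> = x ^ 2 / 24 * (real m ^ 2 * (real m ^ 2 - 1))"
    unfolding sum_weighted_squares[symmetric] by simp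
  also have "\<dots> \<le> x ^ 2 / 24 * (real m ^ 2 * real m ^ 2)"
    by (intro mult_left_mono) auto
  finally have "real m * fejer m x \<ge> real m ^ 2 * (1 - (real m * x) ^ 2 / 12)"
    unfolding fejer_deficit[OF assms] by (simp add: algebra_simps power2_eq_square)
  then have "real m ^ 2 * (1 - (real m * x) ^ 2 / 12) \<le> real m ^ 2 * (fejer m x / real m)"
    using assms by (simp add: power2_eq_square)
  then show ?thesis
    by (rule mult_left_le_imp_le) (use assms in auto)
qed

text \<open>For \<open>y \<le> 11\<close> the quartic term \<open>y * y / 24\<close> uses up at most
  \<open>11 * y / 24\<close> of \<open>y / 2\<close>, so every \<open>1 - cos\<close> keeps at least
  \<open>y / 24\<close>. Together with \<open>m ^ 2 - 1 \<ge> 3 / 4 * m ^ 2\<close> this yields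
  \<open>192\<close>.\<close>

lemma fejer_le_near:
  assumes m: "m \<ge> 2" and x: "(real m * x) ^ 2 \<le> 11"
  shows "fejer m x / real m \<le> 1 - (real m * x) ^ 2 / 192"
proof -
  have "real m ^ 2 * (3 / 4 * real m ^ 2) \<le> real m ^ 2 * (real m ^ 2 - 1)"
  proof (rule mult_left_mono)
    have "4 \<le> real m ^ 2" using m power_mono[of 2 "real m" 2] by simp
    then show "3 / 4 * real m ^ 2 \<le> real m ^ 2 - 1" by linarith
  qed simp
  then have "x ^ 2 / 288 * (real m ^ 2 * (3 / 4 * real m ^ 2)) \<le> x ^ 2 / 288 * (real m ^ 2 * (real m ^ 2 - 1))"
    by (rule mult_left_mono) simp
  also have "\<dots> = x ^ 2 / 24 * (\<Sum>l=1..<m. (real m - real l) * real l ^ 2)"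
    unfolding sum_weighted_squares[symmetric] by simp
  also have "\<dots> = (\<Sum>l=1..<m. (real m - real l) * ((real l * x) ^ 2 / 24))"
    unfolding sum_distrib_left by (intro sum.cong) (auto simp: power_mult_distrib)
  also have "\<dots> \<le> (\<Sum>l=1..<m. (real m - real l) * (1 - cos (real l * x)))"
  proof (intro sum_mono mult_left_mono)
    fix l assume l: "l \<in> {1..<m}"
    then show "0 \<le> real m - real l" by auto
    define y where "y = (real l * x) ^ 2"
    have "y \<le> (real m * x) ^ 2"
      using l unfolding y_def power_mult_distrib by (intro mult_right_mono power_mono) auto
    with x have "y \<le> 11" by simp
    then have "y * y \<le> y * 11" unfolding y_def by (intro mult_left_mono) auto
    moreover have "cos (real l * x) \<le> 1 - y / 2 + y * y / 24"
      using cos_le_quartic[of "real l * x"] by (simp add: y_def power4_eq_xxxx power2_eq_square)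
    ultimately show "(real l * x) ^ 2 / 24 \<le> 1 - cos (real l * x)"
      unfolding y_def[symmetric] by simp
  qed
  finally have "real m * fejer m x \<le> real m ^ 2 * (1 - (real m * x) ^ 2 / 192)"
    unfolding fejer_deficit[OF m] by (simp add: algebra_simps power2_eq_square)
  then have "real m ^ 2 * (fejer m x / real m) \<le> real m ^ 2 * (1 - (real m * x) ^ 2 / 192)"
    using m by (simp add: power2_eq_square)
  then show ?thesis
    by (rule mult_left_le_imp_le) (use m in auto)
qed

text \<open>Jordan's inequality: a concave function lies above its chord, here the chord from
  \<open>0\<close> to \<open>pi / 2\<close>.\<close>

lemma sin_ge_two_over_pi:
  assumes "0 \<le> y" "y \<le> pi / 2"
  shows "2 / pi * y \<le> sin y"
proof -
  have c: "concave_on {0..pi} sin"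
  proof (rule f''_le0_imp_concave)
    show "(sin has_real_derivative cos x) (at x)" for x :: real by (rule DERIV_sin)
    show "(cos has_real_derivative - sin x) (at x)" for x :: real by (rule DERIV_cos)
    show "- sin x \<le> 0" if "x \<in> {0..pi}" for x using that sin_ge_zero by auto
  qed auto
  have "sin ((1 - 2 * y / pi) *\<^sub>R 0 + (2 * y / pi) *\<^sub>R (pi / 2))
      \<ge> (1 - 2 * y / pi) * sin 0 + (2 * y / pi) * sin (pi / 2)"
    using assms by (intro concave_onD[OF c]) (auto simp: field_simps)
  then show ?thesis by simp
qed

text \<open>In the closed form the numerator is at most \<open>1\<close>, and Jordan's inequality
  bounds the denominator from below on a full period.\<close>

lemma fejer_le_far:
  assumes m: "m \<ge> 2" and x: "\<bar>x\<bar> \<le> pi" "x \<noteq> 0"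
  shows "fejer m x / real m \<le> pi ^ 2 / (real m * x) ^ 2"
proof -
  have s: "\<bar>x\<bar> / pi \<le> \<bar>sin (x / 2)\<bar>"
  proof -
    have "\<bar>sin (x / 2)\<bar> = \<bar>sin (\<bar>x\<bar> / 2)\<bar>" by (simp add: abs_if)
    moreover have "2 / pi * (\<bar>x\<bar> / 2) \<le> sin (\<bar>x\<bar> / 2)"
      using x by (intro sin_ge_two_over_pi) auto
    ultimately show ?thesis by simp
  qed
  then have s0: "sin (x / 2) \<noteq> 0" using x by (auto simp: divide_le_0_iff)
  have "fejer m x / real m = (sin (real m * x / 2))\<^sup>2 / (real m ^ 2 * (sin (x / 2))\<^sup>2)"
    unfolding fejer_closed_form[OF m s0] by (simp add: power_divide power2_eq_square)
  also have "\<dots> \<le> 1 / (real m ^ 2 * (\<bar>x\<bar> / pi) ^ 2)"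
  proof (intro frac_le mult_left_mono)
    show "(sin (real m * x / 2))\<^sup>2 \<le> 1" by (simp add: abs_square_le_1)
    show "(\<bar>x\<bar> / pi)\<^sup>2 \<le> (sin (x / 2))\<^sup>2"
      using power_mono[OF s, of 2] by simp
    show "0 < (real m)\<^sup>2 * (\<bar>x\<bar> / pi)\<^sup>2" using m x by auto
  qed auto
  finally show ?thesis by (simp add: power_divide power_mult_distrib)
qed

text \<open>Joins the near and far estimates into one bound whose powers integrate explicitly. The
  threshold \<open>11\<close> is below \<open>12\<close>, as the quartic cosine bound needs, and
  above about \<open>10.4\<close>, where \<open>pi ^ 2 / y\<close> drops below the rational bound;
  \<open>200 \<ge> 192\<close> serves the near case.\<close>

lemma fejer_le_rational:
  assumes m: "m \<ge> 2" and x: "\<bar>x\<bar> \<le> pi"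
  shows "fejer m x / real m \<le> 1 / (1 + (real m * x) ^ 2 / 200)"
proof (cases "(real m * x) ^ 2 \<le> 11")
  case True
  have p: "1 + (real m * x) ^ 2 / 200 > 0" by (simp add: add_pos_nonneg)
  have "(1 - (real m * x) ^ 2 / 192) * (1 + (real m * x) ^ 2 / 200) \<le> 1"
    by (simp add: algebra_simps)
  with p have "1 - (real m * x) ^ 2 / 192 \<le> 1 / (1 + (real m * x) ^ 2 / 200)"
    by (simp add: field_simps)
  with fejer_le_near[OF m True] show ?thesis by simp
next
  case False
  define y where "y = (real m * x) ^ 2"
  have y: "y > 11" using False by (simp add: y_def)
  have "pi < 3.1416" using pi_approx by simp
  then have "pi ^ 2 \<le> 3.1416 ^ 2" by (intro power_mono) auto
  then have p: "pi ^ 2 \<le> 10" "pi ^ 2 < 9.9" by (simp_all add: power2_eq_square)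
  have "pi ^ 2 * (1 + y / 200) = pi ^ 2 + pi ^ 2 * (y / 200)" by (simp add: algebra_simps)
  also have "\<dots> \<le> 9.9 + 10 * (y / 200)"
    using p y by (intro add_mono mult_right_mono) auto
  also have "\<dots> \<le> y" using y by simp
  finally have "pi ^ 2 / y \<le> 1 / (1 + y / 200)" using y by (simp add: field_simps)
  moreover have "x \<noteq> 0" using False by auto
  ultimately show ?thesis using fejer_le_far[OF m x] unfolding y_def by simp
qed

lemma fejer_le:
  assumes "m \<ge> 2"
  shows "fejer m x \<le> real m"
proof -
  have "real m * fejer m x \<le> real m ^ 2"
    unfolding fejer_deficit[OF assms] by (auto intro!: sum_nonneg mult_nonneg_nonneg)
  then show ?thesis using assms by (simp add: power2_eq_square)
qed

lemma fejer_periodic: "fejer m (x + 2 * pi) = fejer m x"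
proof -
  have "cos (real l * (x + 2 * pi)) = cos (real l * x)" for l
    using cos.plus_of_nat[of "real l * x" l] by (simp add: algebra_simps)
  then show ?thesis by (simp add: fejer_def)
qed

text \<open>Bernoulli's inequality is applied to the power \<open>r div 3\<close> and the result
  cubed, so that \<open>r\<close> survives as a factor of \<open>z\<close> while three powers of
  decay remain. The factor \<open>5\<close> is the worst ratio of \<open>r\<close> to
  \<open>r div 3\<close>, attained at \<open>r = 5\<close>.\<close>

lemma Bernoulli_cubed:
  fixes z :: real
  assumes "0 \<le> z" "3 \<le> r"
  shows "(1 + real r * z / 5) ^ 3 \<le> (1 + z) ^ r"
proof -
  define k where "k = r div 3"
  have "3 * k \<le> r" "r \<le> 5 * k" using assms unfolding k_def by presburger+
  have "1 + real r * z / 5 \<le> 1 + real k * z"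
    using \<open>r \<le> 5 * k\<close> assms mult_right_mono[of "real r" "5 * real k" z] by simp
  also have "\<dots> \<le> (1 + z) ^ k" using assms by (intro Bernoulli_inequality) auto
  finally have "(1 + real r * z / 5) ^ 3 \<le> ((1 + z) ^ k) ^ 3"
    using assms by (intro power_mono) auto
  also have "\<dots> = (1 + z) ^ (3 * k)" by (simp add: power_mult[symmetric] mult.commute)
  also have "\<dots> \<le> (1 + z) ^ r" using assms \<open>3 * k \<le> r\<close> by (intro power_increasing) auto
  finally show ?thesis .
qed

subsection \<open>Moments of an exponentially damped periodic weight\<close>

lemma set_integrable_exp_times_quadratic:
  fixes g :: "real \<Rightarrow> real"
  assumes [measurable]: "g \<in> borel_measurable borel" and g: "\<And>u. \<bar>g u\<bar> \<le> K * (1 + u ^ 2)"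
  shows "set_integrable lborel {a..} (\<lambda>u. exp (- u) * g u)"
proof -
  \<comment> \<open>With \<open>u = a + v\<close>, use
    \<open>u ^ 2 \<le> 2 * a ^ 2 + 2 * v ^ 2\<close> and \<open>v ^ 2 \<le> 8 * exp (v / 2)\<close>;
    then \<open>17 = 1 + 2 * 8\<close>. Half of the exponential decay pays for the quadratic
    growth.\<close>
  define B where "B = K * (17 + 2 * a ^ 2) * exp (- a / 2)"
  have K: "K \<ge> 0" using g[of 0] by simp
  have "(\<lambda>t::real. exp (- (1/2) * t)) absolutely_integrable_on {a..}"
    by (intro nonnegative_absolutely_integrable_1 integrable_on_exp_minus_to_infinity) auto
  then have "set_integrable lborel {a..} (\<lambda>t::real. exp (- (1/2) * t))"
    unfolding set_integrable_def by (subst (asm) integrable_completion) auto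
  then have "set_integrable lborel {a..} (\<lambda>t. B * exp (- (1/2) * t))"
    by (intro set_integrable_mult_right)
  then show ?thesis
  proof (rule set_integrable_bound)
    show "set_borel_measurable lborel {a..} (\<lambda>u. exp (- u) * g u)"
      unfolding set_borel_measurable_def by measurable
    show "AE u in lborel. u \<in> {a..} \<longrightarrow> norm (exp (- u) * g u) \<le> norm (B * exp (- (1/2) * u))"
    proof (intro AE_I2 impI)
      fix u assume "u \<in> {a..}"
      define v where "v = u - a"
      have v: "v \<ge> 0" "u = a + v" using \<open>u \<in> {a..}\<close> by (auto simp: v_def)
      have "v ^ 2 / 8 \<le> exp (v / 2)"
        using exp_lower_Taylor_quadratic[of "v / 2"] v by (simp add: power_divide)
      moreover have "1 \<le> exp (v / 2)" using v by simp
      moreover have "u ^ 2 \<le> 2 * a ^ 2 + 2 * v ^ 2"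
        unfolding v(2) using zero_le_power2[of "a - v"] by (simp add: algebra_simps power2_eq_square)
      moreover have "a ^ 2 * 1 \<le> a ^ 2 * exp (v / 2)" using v by (intro mult_left_mono) auto
      moreover have "(17 + 2 * a ^ 2) * exp (v / 2) = 17 * exp (v / 2) + 2 * (a ^ 2 * exp (v / 2))"
        by (simp add: algebra_simps)
      ultimately have "1 + u ^ 2 \<le> (17 + 2 * a ^ 2) * exp (v / 2)"
        by linarith
      then have "exp (- u) * (K * (1 + u ^ 2)) \<le> exp (- u) * (K * ((17 + 2 * a ^ 2) * exp (v / 2)))"
        using K by (intro mult_left_mono) auto
      also have "\<dots> = K * (17 + 2 * a ^ 2) * (exp (- u) * exp (v / 2))"
        by simp
      also have "exp (- u) * exp (v / 2) = exp (- a / 2) * exp (- (1/2) * u)"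
        unfolding exp_add[symmetric] v(2) by (simp add: field_simps)
      finally have "exp (- u) * (K * (1 + u ^ 2)) \<le> B * exp (- (1/2) * u)"
        by (simp add: B_def mult_ac)
      moreover have "exp (- u) * \<bar>g u\<bar> \<le> exp (- u) * (K * (1 + u ^ 2))"
        using g by (intro mult_left_mono) auto
      ultimately have "exp (- u) * \<bar>g u\<bar> \<le> B * exp (- (1/2) * u)" by linarith
      moreover have "B \<ge> 0" using K by (simp add: B_def)
      ultimately show "norm (exp (- u) * g u) \<le> norm (B * exp (- (1/2) * u))"
        by (simp add: abs_mult)
    qed
  qed
qed

lemma set_integral_shift_real:
  fixes F :: "real \<Rightarrow> real"
  shows "(LBINT u:{a..}. F (u + h)) = (LBINT u:{a + h..}. F u)"
  unfolding set_lebesgue_integral_def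
  by (subst lborel_integral_real_affine[of 1 _ h]) (auto simp: indicator_def add.commute intro!: Bochner_Integration.integral_cong)

lemma set_integral_atLeast_split:
  fixes F :: "real \<Rightarrow> real"
  assumes "set_integrable lborel {a..} F" "h > 0"
  shows "(LBINT u:{a..}. F u) = (LBINT u:{a..<a + h}. F u) + (LBINT u:{a..}. F (u + h))"
proof -
  have e: "{a..} = {a..<a + h} \<union> {a + h..}" using assms by auto
  show ?thesis
    unfolding set_integral_shift_real
    by (subst e, rule set_integral_Un) (auto intro!: set_integrable_subset[OF assms(1)] simp: assms less_imp_le)
qed

text \<open>Shifting by one period multiplies \<^term>\<open>\<lambda>u. exp (- u) * w u\<close> by \<^term>\<open>exp (- h)\<close>, so each
  integral over the half-line satisfies a linear inequality in terms of itself.\<close>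

lemma periodic_weight_second_moment:
  fixes w :: "real \<Rightarrow> real"
  assumes [measurable]: "w \<in> borel_measurable borel"
    and w: "\<And>u. 0 \<le> w u" "\<And>u. w u \<le> 1" and per: "\<And>u. w (u + h) = w u"
    and h: "h > 0" "exp (- h) \<le> 1 / 4"
  shows "(LBINT u:{a..}. exp (- u) * (u ^ 2 * w u))
      \<le> 2 * (LBINT u:{a..<a + h}. exp (- u) * (u ^ 2 * w u))
        + 6 * h ^ 2 * exp (- h) * (LBINT u:{a..<a + h}. exp (- u) * w u)"
proof -
  define A0 A2 I0 I2 where "A0 = (LBINT u:{a..}. exp (- u) * w u)"
    and "A2 = (LBINT u:{a..}. exp (- u) * (u ^ 2 * w u))"
    and "I0 = (LBINT u:{a..<a + h}. exp (- u) * w u)"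
    and "I2 = (LBINT u:{a..<a + h}. exp (- u) * (u ^ 2 * w u))"
  have i0: "set_integrable lborel {a..} (\<lambda>u. exp (- u) * w u)"
  proof (rule set_integrable_exp_times_quadratic[where K = 1])
    show "\<bar>w u\<bar> \<le> 1 * (1 + u ^ 2)" for u using w[of u] by (simp add: add_increasing2)
  qed simp
  have i2: "set_integrable lborel {a..} (\<lambda>u. exp (- u) * (u ^ 2 * w u))"
  proof (rule set_integrable_exp_times_quadratic[where K = 1])
    show "\<bar>u ^ 2 * w u\<bar> \<le> 1 * (1 + u ^ 2)" for u
      using w[of u] mult_left_mono[OF w(2)[of u], of "u ^ 2"] by (simp add: abs_mult)
  qed simp
  have i2s: "set_integrable lborel {a..} (\<lambda>u. exp (- u) * ((u + h) ^ 2 * w u))"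
  proof (rule set_integrable_exp_times_quadratic[where K = "2 + 2 * h ^ 2"])
    show "\<bar>(u + h) ^ 2 * w u\<bar> \<le> (2 + 2 * h ^ 2) * (1 + u ^ 2)" for u
    proof -
      have "(u + h) ^ 2 * w u \<le> (u + h) ^ 2 * 1" using w by (intro mult_left_mono) auto
      also have "\<dots> \<le> 2 * u ^ 2 + 2 * h ^ 2"
        using zero_le_power2[of "u - h"] by (simp add: power2_eq_square algebra_simps)
      also have "\<dots> \<le> (2 + 2 * h ^ 2) * (1 + u ^ 2)"
        by (simp add: algebra_simps)
      finally show ?thesis using w[of u] by (simp add: abs_mult)
    qed
  qed simp
  have "A0 = I0 + (LBINT u:{a..}. exp (- (u + h)) * w (u + h))"
    unfolding A0_def I0_def by (rule set_integral_atLeast_split[OF i0 h(1)])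
  also have "(LBINT u:{a..}. exp (- (u + h)) * w (u + h)) = exp (- h) * A0"
    unfolding A0_def per by (subst set_integral_mult_right[symmetric]) (simp add: exp_add exp_diff exp_minus field_simps)
  finally have A0: "A0 = I0 + exp (- h) * A0" .
  have A0_nonneg: "A0 \<ge> 0" unfolding A0_def set_lebesgue_integral_def using w by simp
  have A2_nonneg: "A2 \<ge> 0" unfolding A2_def set_lebesgue_integral_def using w by simp
  have "exp (- h) * A0 \<le> 1/4 * A0" using A0_nonneg h by (intro mult_right_mono)
  with A0 have A0': "A0 \<le> 4 / 3 * I0" by simp
  have "A2 = I2 + (LBINT u:{a..}. exp (- (u + h)) * ((u + h) ^ 2 * w (u + h)))"
    unfolding A2_def I2_def by (rule set_integral_atLeast_split[OF i2 h(1)])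
  also have "(LBINT u:{a..}. exp (- (u + h)) * ((u + h) ^ 2 * w (u + h)))
      = exp (- h) * (LBINT u:{a..}. exp (- u) * ((u + h) ^ 2 * w u))"
    unfolding per by (subst set_integral_mult_right[symmetric]) (simp add: exp_add exp_diff exp_minus field_simps)
  also have "(LBINT u:{a..}. exp (- u) * ((u + h) ^ 2 * w u))
      \<le> (LBINT u:{a..}. 2 * (exp (- u) * (u ^ 2 * w u)) + 2 * h ^ 2 * (exp (- u) * w u))"
  proof (rule set_integral_mono[OF i2s])
    show "set_integrable lborel {a..} (\<lambda>u. 2 * (exp (- u) * (u ^ 2 * w u)) + 2 * h ^ 2 * (exp (- u) * w u))"
      by (intro set_integral_add set_integrable_mult_right i0 i2)
    fix u
    have "(u + h) ^ 2 \<le> 2 * u ^ 2 + 2 * h ^ 2"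
      using zero_le_power2[of "u - h"] by (simp add: power2_eq_square algebra_simps)
    then have "(exp (- u) * w u) * (u + h) ^ 2 \<le> (exp (- u) * w u) * (2 * u ^ 2 + 2 * h ^ 2)"
      using w by (intro mult_left_mono) auto
    then show "exp (- u) * ((u + h) ^ 2 * w u) \<le> 2 * (exp (- u) * (u ^ 2 * w u)) + 2 * h ^ 2 * (exp (- u) * w u)"
      by (simp add: algebra_simps)
  qed
  also have "(LBINT u:{a..}. 2 * (exp (- u) * (u ^ 2 * w u)) + 2 * h ^ 2 * (exp (- u) * w u))
      = 2 * A2 + 2 * h ^ 2 * A0"
    unfolding A0_def A2_def
    by (subst set_integral_add) (simp_all add: set_integrable_mult_right i0 i2)
  \<comment> \<open>As \<open>exp (- h) \<le> 1 / 4\<close>, the \<open>A2\<close> on the right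
    costs at most half of the left side and is absorbed. Doubling then gives \<open>2 * I2\<close>
    and \<open>16 / 3 \<le> 6\<close> for the other coefficient.\<close>
  finally have "A2 \<le> I2 + exp (- h) * (2 * A2 + 2 * h ^ 2 * A0)" by simp
  moreover have "exp (- h) * A2 \<le> 1/4 * A2" using A2_nonneg h by (intro mult_right_mono)
  moreover have "exp (- h) * h ^ 2 * A0 \<le> exp (- h) * h ^ 2 * (4 / 3 * I0)"
    using A0' by (intro mult_left_mono) auto
  moreover have "0 \<le> exp (- h) * h ^ 2 * I0"
    using A0' A0_nonneg by simp
  moreover have "exp (- h) * (2 * A2 + 2 * h ^ 2 * A0) = 2 * (exp (- h) * A2) + 2 * (exp (- h) * h ^ 2 * A0)"
    "exp (- h) * h ^ 2 * (4 / 3 * I0) = 4 / 3 * (exp (- h) * h ^ 2 * I0)"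
    by (simp_all add: algebra_simps)
  ultimately have "A2 \<le> 2 * I2 + 6 * (exp (- h) * h ^ 2 * I0)"
    by linarith
  then show ?thesis unfolding A2_def I2_def I0_def by (simp add: mult_ac)
qed

section \<open>Moments of a single peak\<close>

lemma integral_inverse_quadratic:
  fixes b c :: real
  assumes "b > 0" "c > 0"
  shows "integrable lborel (\<lambda>u. 1 / (1 + b * u ^ 2) * indicator {-c..c} u)"
    and "(LBINT u. 1 / (1 + b * u ^ 2) * indicator {-c..c} u) \<le> pi / sqrt b"
proof -
  have p: "1 + b * u ^ 2 > 0" for u using assms by (simp add: add_pos_nonneg)
  have F: "has_bochner_integral lborel (\<lambda>u. 1 / (1 + b * u ^ 2) * indicator {-c..c} u)
      (arctan (sqrt b * c) / sqrt b - arctan (sqrt b * - c) / sqrt b)"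
  proof (rule has_bochner_integral_FTC_Icc_real)
    have "b + b * (b * u ^ 2) > 0" for u using assms by (simp add: add_pos_nonneg)
    then have "b + b * (b * u ^ 2) \<noteq> 0" for u by (metis less_irrefl)
    then show "DERIV (\<lambda>u. arctan (sqrt b * u) / sqrt b) u :> 1 / (1 + b * u ^ 2)" for u
      using assms p[of u] by (auto intro!: derivative_eq_intros simp: field_simps power_mult_distrib)
    show "isCont (\<lambda>u. 1 / (1 + b * u ^ 2)) u" for u
      using p[of u] by (intro continuous_intros) auto
  qed (use assms in auto)
  show "integrable lborel (\<lambda>u. 1 / (1 + b * u ^ 2) * indicator {-c..c} u)"
    using F by (rule integrable.intros)
  have "arctan (sqrt b * c) - arctan (sqrt b * - c) \<le> pi"
    using arctan_ubound[of "sqrt b * c"] by (simp add: arctan_minus)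
  then have "(arctan (sqrt b * c) - arctan (sqrt b * - c)) / sqrt b \<le> pi / sqrt b"
    using assms by (intro divide_right_mono) auto
  then show "(LBINT u. 1 / (1 + b * u ^ 2) * indicator {-c..c} u) \<le> pi / sqrt b"
    unfolding has_bochner_integral_integral_eq[OF F] by (simp add: diff_divide_distrib)
qed

text \<open>Of the three powers of \<open>1 + b * u ^ 2\<close>, one absorbs
  \<open>exp (- u)\<close>, one absorbs \<open>u ^ 2\<close> at the price \<open>1 / b\<close>, and
  the last integrates to at most \<open>pi / sqrt b\<close> through \<open>arctan\<close>.\<close>

lemma peak_moments:
  fixes w :: "real \<Rightarrow> real"
  assumes [measurable]: "w \<in> borel_measurable borel"
    and w: "\<And>u. 0 \<le> w u" "\<And>u. \<bar>u\<bar> \<le> c \<Longrightarrow> w u \<le> 1 / (1 + b * u ^ 2) ^ 3"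
    and c: "c \<ge> 1" "exp c \<le> b"
  shows "(LBINT u:{-c..<c}. exp (- u) * w u) \<le> exp 1 * pi / sqrt b"
    and "(LBINT u:{-c..<c}. exp (- u) * (u ^ 2 * w u)) \<le> exp 1 * pi / (b * sqrt b)"
proof -
  have b: "b > 0" using c(2) exp_gt_zero[of c] by linarith
  have p: "1 + b * u ^ 2 > 0" for u using b by (simp add: add_pos_nonneg)
  have w': "exp (- u) * w u \<le> exp 1 / (1 + b * u ^ 2) ^ 2" if u: "\<bar>u\<bar> \<le> c" for u
  proof -
    \<comment> \<open>For \<open>u < -1\<close> the exponential is at most
      \<open>exp c \<le> b \<le> b * u ^ 2\<close>; this is where the size of \<open>b\<close>
      relative to the window enters.\<close>
    have "exp (- u) \<le> exp 1 * (1 + b * u ^ 2)"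
    proof (cases "u \<ge> -1")
      case True
      then have "exp (- u) \<le> exp 1 * 1" by simp
      also have "\<dots> \<le> exp 1 * (1 + b * u ^ 2)" using b by (intro mult_left_mono) auto
      finally show ?thesis .
    next
      case False
      have "1 \<le> u ^ 2" using False power_mono[of 1 "- u" 2] by simp
      have "exp (- u) \<le> exp c" using u by auto
      also have "\<dots> \<le> b * 1" using c(2) by simp
      also have "\<dots> \<le> b * u ^ 2" using \<open>1 \<le> u ^ 2\<close> b by (intro mult_left_mono) auto
      also have "\<dots> \<le> 1 * (1 + b * u ^ 2)" by simp
      also have "\<dots> \<le> exp 1 * (1 + b * u ^ 2)"
        using p[of u] by (intro mult_right_mono) (auto simp: less_imp_le)
      finally show ?thesis .
    qed
    then have "exp (- u) * w u \<le> exp 1 * (1 + b * u ^ 2) * (1 / (1 + b * u ^ 2) ^ 3)"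
      using w(1)[of u] w(2)[OF u] p[of u] by (intro mult_mono) auto
    also have "\<dots> = exp 1 / (1 + b * u ^ 2) ^ 2"
      using p[of u] by (simp add: power2_eq_square power3_eq_cube)
    finally show ?thesis .
  qed
  \<comment> \<open>Both moments are dominated by the same arctangent integrand, with
    \<open>K = exp 1\<close> and \<open>K = exp 1 / b\<close>.\<close>
  have le: "(LBINT u:{-c..<c}. g u) \<le> K * (pi / sqrt b)"
    if g [measurable]: "g \<in> borel_measurable borel" and K: "K \<ge> 0"
      and gle: "\<And>u. \<bar>u\<bar> \<le> c \<Longrightarrow> 0 \<le> g u \<and> g u \<le> K * (1 / (1 + b * u ^ 2))" for g K
  proof -
    have c0: "c > 0" using c by simp
    have i: "integrable lborel (\<lambda>u. K * (1 / (1 + b * u ^ 2) * indicator {-c..c} u))"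
      by (intro integrable_mult_right integral_inverse_quadratic b c0)
    have "(LBINT u:{-c..<c}. g u) \<le> (LBINT u. K * (1 / (1 + b * u ^ 2) * indicator {-c..c} u))"
      unfolding set_lebesgue_integral_def
    proof (rule integral_mono)
      show "indicat_real {- c..<c} u *\<^sub>R g u \<le> K * (1 / (1 + b * u ^ 2) * indicator {-c..c} u)" for u
        using gle[of u] p[of u] K by (auto simp: indicator_def)
      show "integrable lborel (\<lambda>u. indicat_real {- c..<c} u *\<^sub>R g u)"
      proof (rule Bochner_Integration.integrable_bound[OF i])
        show "AE u in lborel. norm (indicat_real {- c..<c} u *\<^sub>R g u)
            \<le> norm (K * (1 / (1 + b * u ^ 2) * indicator {-c..c} u))"
        proof (rule AE_I2)
          show "norm (indicat_real {- c..<c} u *\<^sub>R g u)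
            \<le> norm (K * (1 / (1 + b * u ^ 2) * indicator {-c..c} u))" for u
            using gle[of u] p[of u] K by (auto simp: indicator_def)
        qed
      qed measurable
    qed (rule i)
    also have "\<dots> \<le> K * (pi / sqrt b)"
      unfolding integral_mult_right_zero by (rule mult_left_mono[OF integral_inverse_quadratic(2)[OF b c0] K])
    finally show ?thesis .
  qed
  have "(LBINT u:{-c..<c}. exp (- u) * w u) \<le> exp 1 * (pi / sqrt b)"
  proof (rule le)
    fix u assume u: "\<bar>u\<bar> \<le> c"
    have "exp 1 / (1 + b * u ^ 2) ^ 2 \<le> exp 1 / (1 + b * u ^ 2)"
      using p[of u] b by (intro divide_left_mono) (auto simp: power2_eq_square mult_left_mono intro!: self_le_power)
    with w'[OF u] w(1)[of u] show "0 \<le> exp (- u) * w u \<and> exp (- u) * w u \<le> exp 1 * (1 / (1 + b * u ^ 2))"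
      by simp
  qed auto
  then show "(LBINT u:{-c..<c}. exp (- u) * w u) \<le> exp 1 * pi / sqrt b" by simp
  have "(LBINT u:{-c..<c}. exp (- u) * (u ^ 2 * w u)) \<le> exp 1 / b * (pi / sqrt b)"
  proof (rule le)
    fix u assume u: "\<bar>u\<bar> \<le> c"
    have "u ^ 2 * (exp (- u) * w u) \<le> u ^ 2 * (exp 1 / (1 + b * u ^ 2) ^ 2)"
      using w'[OF u] by (intro mult_left_mono) auto
    also have "\<dots> = exp 1 / b * ((b * u ^ 2) / (1 + b * u ^ 2)) * (1 / (1 + b * u ^ 2))"
      using b p[of u] by (simp add: power2_eq_square)
    also have "\<dots> \<le> exp 1 / b * 1 * (1 / (1 + b * u ^ 2))"
      using b p[of u] by (intro mult_right_mono mult_left_mono) auto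
    finally show "0 \<le> exp (- u) * (u ^ 2 * w u) \<and> exp (- u) * (u ^ 2 * w u) \<le> exp 1 / b * (1 / (1 + b * u ^ 2))"
      using w(1)[of u] by (simp add: mult_ac)
  qed (use b in auto)
  then show "(LBINT u:{-c..<c}. exp (- u) * (u ^ 2 * w u)) \<le> exp 1 * pi / (b * sqrt b)"
    by simp
qed

section \<open>Variance of a bounded density\<close>

text \<open>A bounded density puts mass at most \<open>1/2\<close> within \<open>1 / (4 * D)\<close> of the mean.\<close>

lemma variance_ge_of_density_le:
  fixes X :: "'a \<Rightarrow> real" and f :: "real \<Rightarrow> real"
  assumes "prob_space M" and X: "distributed M lborel X (\<lambda>t. ennreal (f t))"
    and f: "\<And>t. 0 \<le> f t" "\<And>t. f t \<le> D" and D: "D > 0"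
    and int: "integrable M X" "integrable M (\<lambda>x. X x ^ 2)"
  shows "1 / (32 * D ^ 2) \<le> prob_space.variance M X"
proof -
  interpret prob_space M by fact
  define \<mu> a where "\<mu> = expectation X" and "a = 1 / (4 * D)"
  have a: "a > 0" using D by (simp add: a_def)
  have "integrable M (\<lambda>x. (X x - \<mu>) ^ 2)"
    using int by (simp add: power2_diff)
  then have i: "integrable lborel (\<lambda>t. f t * (t - \<mu>) ^ 2)"
    using distributed_integrable[OF X, of "\<lambda>t. (t - \<mu>) ^ 2"] f by simp
  have fi: "integrable lborel f" "integral\<^sup>L lborel f = 1"
    using distributed_integrable[OF X, of "\<lambda>_. 1"] distributed_integral[OF X, of "\<lambda>_. 1"] f
    by (simp_all add: prob_space)
  \<comment> \<open>A pointwise lower bound for \<open>f t * (t - \<mu>) ^ 2\<close>: inside the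
    interval it is \<open>a ^ 2 * (f t - D) \<le> 0\<close>, outside the squared distance is at
    least \<open>a ^ 2\<close>. Its integral is \<open>a ^ 2 * (1 - 2 * a * D)\<close>, which
    \<open>a = 1 / (4 * D)\<close> makes \<open>a ^ 2 / 2\<close>.\<close>
  let ?g = "\<lambda>t. a ^ 2 * f t - a ^ 2 * D * indicator {\<mu> - a..\<mu> + a} t"
  have "integrable lborel (indicator {\<mu> - a..\<mu> + a} :: real \<Rightarrow> real)"
    by (rule integrable_real_indicator) (auto simp: emeasure_lborel_Icc_eq)
  note fi = fi this
  have gi: "integrable lborel ?g"
    using fi by (intro Bochner_Integration.integrable_diff integrable_mult_right) auto
  have "(LBINT t. ?g t) \<le> (LBINT t. f t * (t - \<mu>) ^ 2)"
  proof (rule integral_mono[OF gi i])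
    fix t
    show "?g t \<le> f t * (t - \<mu>) ^ 2"
    proof (cases "t \<in> {\<mu> - a..\<mu> + a}")
      case True
      have "a ^ 2 * f t \<le> a ^ 2 * D" using f by (intro mult_left_mono) auto
      with True f[of t] show ?thesis by (simp add: order.trans[of _ 0])
    next
      case False
      then have "a \<le> \<bar>t - \<mu>\<bar>" by auto
      then have "a ^ 2 \<le> (t - \<mu>) ^ 2" using a power_mono[of a "\<bar>t - \<mu>\<bar>" 2] by simp
      with False f[of t] show ?thesis by (simp add: mult.commute mult_left_mono)
    qed
  qed
  also have "(LBINT t. f t * (t - \<mu>) ^ 2) = variance X"
    using distributed_integral[OF X, of "\<lambda>t. (t - \<mu>) ^ 2"] f by (simp add: \<mu>_def)
  also have "(LBINT t. ?g t) = a ^ 2 - a ^ 2 * D * (2 * a)"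
    using fi a by (subst Bochner_Integration.integral_diff) (auto intro!: integrable_mult_right)
  also have "\<dots> = 1 / (32 * D ^ 2)"
    using D by (simp add: a_def field_simps power2_eq_square)
  finally show ?thesis .
qed

subsection \<open>The PF-CME density\<close>

definition pf_weight :: "nat \<Rightarrow> real \<Rightarrow> real" where
  "pf_weight m u = (fejer m (pf_omega m * u) / real m) ^ pf_r m"

definition pf_mass :: "nat \<Rightarrow> real" where
  "pf_mass m = (LBINT t:{0..}. exp (- t) * pf_weight m (t - 1))"

text \<open>Taken about the peak \<open>1\<close> instead of the mean, which has no explicit form,
  and not yet divided by \<open>pf_mass\<close>.\<close>

definition pf_moment :: "nat \<Rightarrow> real" where
  "pf_moment m = (LBINT t:{0..}. exp (- t) * ((t - 1) ^ 2 * pf_weight m (t - 1)))"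

lemma pf_weight_measurable [measurable]: "pf_weight m \<in> borel_measurable borel"
proof -
  have [measurable]: "fejer m \<in> borel_measurable borel"
    unfolding fejer_def by (intro borel_measurable_continuous_onI continuous_intros)
  show ?thesis unfolding pf_weight_def by measurable
qed

lemma pf_weight_nonneg: "m \<ge> 2 \<Longrightarrow> pf_weight m u \<ge> 0"
  by (simp add: pf_weight_def fejer_nonneg)

lemma pf_weight_le_1: "m \<ge> 2 \<Longrightarrow> pf_weight m u \<le> 1"
  unfolding pf_weight_def by (intro power_le_one) (auto simp: fejer_nonneg fejer_le)

lemma pf_W_eq: "m \<ge> 2 \<Longrightarrow> pf_W m (pf_omega m * u) = real m ^ pf_r m * pf_weight m u"
  by (simp add: pf_W_def pf_weight_def power_divide)

lemma pf_C_eq: "m \<ge> 2 \<Longrightarrow> pf_C m = 1 / (real m ^ pf_r m * pf_mass m)"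
  unfolding pf_C_def pf_mass_def
  by (subst set_integral_mult_right[symmetric]) (simp add: pf_W_eq mult_ac)

lemma pf_mass_pos:
  assumes "m \<ge> 2"
  shows "pf_mass m > 0"
  using pf_C_pos[OF assms] assms unfolding pf_C_eq[OF assms]
  by (simp add: zero_less_mult_iff)

lemma pf_cme_density_eq:
  assumes "m \<ge> 2"
  shows "pf_cme_density m t = indicator {0..} t * (exp (- t) * pf_weight m (t - 1)) / pf_mass m"
  using assms by (simp add: pf_cme_density_def pf_C_eq pf_W_eq)

lemma pf_cme_density_le:
  assumes "m \<ge> 2"
  shows "pf_cme_density m t \<le> 1 / pf_mass m"
proof -
  have "indicator {0..} t * (exp (- t) * pf_weight m (t - 1)) \<le> 1"
    using mult_mono[of "exp (- t)" 1 "pf_weight m (t - 1)" 1] assms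
    by (auto simp: indicator_def pf_weight_nonneg pf_weight_le_1)
  then show ?thesis
    unfolding pf_cme_density_eq[OF assms]
    using pf_mass_pos[OF assms] by (intro divide_right_mono) auto
qed

lemma pf_cme_moments:
  fixes X :: "'a \<Rightarrow> real"
  assumes m: "m \<ge> 2" and X: "distributed M lborel X (\<lambda>t. ennreal (pf_cme_density m t))"
  shows "prob_space M \<Longrightarrow> integrable M X" and "integrable M (\<lambda>x. X x ^ 2)"
    and "(LINT x|M. (X x - 1) ^ 2) = pf_moment m / pf_mass m"
proof -
  have w: "\<bar>pf_weight m u\<bar> \<le> 1" for u
    using pf_weight_nonneg[OF m, of u] pf_weight_le_1[OF m, of u] by simp
  have [measurable]: "X \<in> borel_measurable M"
    using distributed_measurable[OF X] by simp
  have "set_integrable lborel {0..} (\<lambda>t. exp (- t) * (t ^ 2 * pf_weight m (t - 1)))"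
  proof (rule set_integrable_exp_times_quadratic[where K = 1])
    show "\<bar>t ^ 2 * pf_weight m (t - 1)\<bar> \<le> 1 * (1 + t ^ 2)" for t
      using mult_left_mono[OF w[of "t - 1"], of "t ^ 2"] by (simp add: abs_mult)
  qed simp
  then have "integrable lborel (\<lambda>t. (indicator {0..} t *\<^sub>R (exp (- t) * (t ^ 2 * pf_weight m (t - 1)))) / pf_mass m)"
    unfolding set_integrable_def by (rule integrable_divide_zero)
  also have "(\<lambda>t. (indicator {0..} t *\<^sub>R (exp (- t) * (t ^ 2 * pf_weight m (t - 1)))) / pf_mass m)
      = (\<lambda>t. pf_cme_density m t * t ^ 2)"
    by (auto simp: pf_cme_density_eq[OF m])
  finally show 2: "integrable M (\<lambda>x. X x ^ 2)"
    using distributed_integrable[OF X, of "\<lambda>t. t ^ 2"] pf_cme_density_nonneg[OF m] by simp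
  show "integrable M X" if "prob_space M"
  proof -
    interpret prob_space M by fact
    show ?thesis by (rule square_integrable_imp_integrable[OF _ 2]) simp
  qed
  have "(LINT x|M. (X x - 1) ^ 2) = (LBINT t. pf_cme_density m t * (t - 1) ^ 2)"
    using distributed_integral[OF X, of "\<lambda>t. (t - 1) ^ 2"] pf_cme_density_nonneg[OF m] by simp
  also have "\<dots> = (LBINT t. (indicator {0..} t *\<^sub>R (exp (- t) * ((t - 1) ^ 2 * pf_weight m (t - 1)))) / pf_mass m)"
    by (intro Bochner_Integration.integral_cong) (auto simp: pf_cme_density_eq[OF m])
  also have "\<dots> = pf_moment m / pf_mass m"
    unfolding pf_moment_def set_lebesgue_integral_def by (rule integral_divide_zero)
  finally show "(LINT x|M. (X x - 1) ^ 2) = pf_moment m / pf_mass m" .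
qed


text \<open>Collects the parameter estimates in terms of \<open>ln m\<close>. The last conjunct
  prepares \<open>exp (h / 2) \<le> b\<close>: its left side equals \<open>exp (pf_h m / 2)\<close>,
  and its right side will be a lower bound for the peak sharpness \<open>b\<close>.\<close>

lemma pf_eventually_bounds:
  "\<forall>\<^sub>F m in sequentially. m \<ge> 2 \<and> 1 \<le> ln (real m) \<and> ln (real m) \<le> real (pf_r m) \<and> real (pf_r m) \<le> 2 * ln (real m)
     \<and> 2 * ln (real m) \<le> pf_h m \<and> pf_h m \<le> 3 * ln (real m) \<and> 3 \<le> pf_r m
     \<and> real m * sqrt (ln (real m)) \<le> real m ^ 2 / (250 * ln (real m))"
proof -
  have "\<forall>\<^sub>F m in sequentially. 3 \<le> ln (real m)" by real_asymp
  moreover have "\<forall>\<^sub>F m in sequentially. real m * sqrt (ln (real m)) \<le> real m ^ 2 / (250 * ln (real m))"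
    by real_asymp
  ultimately show ?thesis
    using eventually_ge_at_top[of 2]
  proof eventually_elim
    case (elim m)
    have r: "real (pf_r m) = of_int \<lceil>ln (real m)\<rceil>"
      using elim unfolding pf_r_def by (simp add: le_ceiling_iff)
    have r1: "ln (real m) \<le> real (pf_r m)" unfolding r by (rule le_of_int_ceiling)
    have "real (pf_r m) < ln (real m) + 1" unfolding r by linarith
    then have r2: "real (pf_r m) \<le> 2 * ln (real m)" using elim by linarith
    have "ln (ln (real m)) \<le> ln (real m)"
      using elim ln_le_minus_one[of "ln (real m)"] by linarith
    moreover have "ln (ln (real m)) \<ge> 0" using elim by (intro ln_ge_zero) auto
    ultimately show ?case
      using elim r1 r2 by (auto simp: pf_h_def)
  qed
qed

text \<open>Shows the purpose of the term \<open>ln (ln m)\<close> in \<open>pf_h\<close>: its extra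
  factor \<open>1 / ln m\<close> reduces \<open>h ^ 2 * exp (- h)\<close> to order
  \<open>ln m / m ^ 2\<close>.\<close>

lemma pf_h_exp:
  assumes "1 \<le> ln (real m)" "m \<ge> 2"
  shows "exp (- pf_h m) = 1 / (real m ^ 2 * ln (real m))" "exp (pf_h m / 2) = real m * sqrt (ln (real m))"
proof -
  show "exp (- pf_h m) = 1 / (real m ^ 2 * ln (real m))"
    using assms unfolding pf_h_def exp_minus exp_add by (simp add: exp_double inverse_eq_divide)
  have "exp (pf_h m / 2) = sqrt (exp (pf_h m))"
    by (rule real_sqrt_unique[symmetric]) (simp_all add: exp_double[symmetric])
  also have "exp (pf_h m) = real m ^ 2 * ln (real m)"
    using assms unfolding pf_h_def by (simp add: exp_add exp_double)
  also have "sqrt \<dots> = real m * sqrt (ln (real m))"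
    by (simp add: real_sqrt_mult)
  finally show "exp (pf_h m / 2) = real m * sqrt (ln (real m))" .
qed

section \<open>Pointwise bounds for the weight and the integrals they control\<close>

lemma pf_weight_periodic:
  assumes "pf_h m \<noteq> 0"
  shows "pf_weight m (u + pf_h m) = pf_weight m u"
proof -
  have "pf_omega m * (u + pf_h m) = pf_omega m * u + 2 * pi"
    using assms by (simp add: pf_omega_def field_simps)
  then show ?thesis by (simp add: pf_weight_def fejer_periodic)
qed

text \<open>Half a period in \<open>u\<close> corresponds to \<open>\<bar>x\<bar> \<le> pi\<close>,
  so the rational kernel bound applies and \<open>Bernoulli_cubed\<close> handles its power;
  \<open>1000 = 200 * 5\<close>.\<close>

lemma pf_weight_peak:
  assumes m: "m \<ge> 2" and r: "3 \<le> pf_r m" and u: "\<bar>u\<bar> \<le> pf_h m / 2" and h: "pf_h m > 0"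
  shows "pf_weight m u \<le> 1 / (1 + (real (pf_r m) * (real m * pf_omega m) ^ 2 / 1000) * u ^ 2) ^ 3"
proof -
  define z where "z = (real m * (pf_omega m * u)) ^ 2 / 200"
  have z: "z \<ge> 0" by (simp add: z_def)
  have "\<bar>pf_omega m * u\<bar> \<le> pi"
    using u h by (simp add: pf_omega_def abs_mult field_simps)
  then have "pf_weight m u \<le> (1 / (1 + z)) ^ pf_r m"
    unfolding pf_weight_def z_def using m
    by (intro power_mono fejer_le_rational divide_nonneg_nonneg fejer_nonneg) auto
  also have "\<dots> = 1 / (1 + z) ^ pf_r m" by (simp add: power_divide)
  also have "\<dots> \<le> 1 / (1 + real (pf_r m) * z / 5) ^ 3"
    using z by (intro divide_left_mono Bernoulli_cubed r mult_pos_pos zero_less_power add_pos_nonneg) auto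
  also have "real (pf_r m) * z / 5 = (real (pf_r m) * (real m * pf_omega m) ^ 2 / 1000) * u ^ 2"
    by (simp add: z_def power_mult_distrib)
  finally show ?thesis .
qed

text \<open>By \<open>fejer_ge\<close> and Bernoulli's inequality the weight loses at most
  \<open>r * y \<le> 1 / 12\<close> from its maximum \<open>1\<close>.\<close>

lemma pf_weight_ge_half:
  assumes m: "m \<ge> 2" and r: "3 \<le> pf_r m" and u: "real (pf_r m) * (real m * pf_omega m * u) ^ 2 \<le> 1"
  shows "pf_weight m u \<ge> 1 / 2"
proof -
  define y where "y = (real m * (pf_omega m * u)) ^ 2 / 12"
  have ry: "real (pf_r m) * y \<le> 1 / 12" using u by (simp add: y_def mult_ac)
  have "3 * y \<le> real (pf_r m) * y" using r by (intro mult_right_mono) (auto simp: y_def)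
  with ry have y: "y \<le> 1" by simp
  have "1 / 2 \<le> 1 + real (pf_r m) * (- y)" using ry by simp
  also have "\<dots> \<le> (1 + (- y)) ^ pf_r m" using y by (intro Bernoulli_inequality) auto
  also have "\<dots> \<le> pf_weight m u"
    unfolding pf_weight_def
    by (rule power_mono) (use fejer_ge[OF m, of "pf_omega m * u"] y in \<open>auto simp: y_def\<close>)
  finally show ?thesis .
qed

text \<open>Only the right flank \<open>{1..1 + d}\<close> of the first peak is counted: there the
  weight is at least \<open>1 / 2\<close> and the exponential at least
  \<open>exp (- 2)\<close>.\<close>

lemma pf_mass_ge:
  assumes m: "m \<ge> 2" and r: "3 \<le> pf_r m" and d: "0 \<le> d" "d \<le> 1"
    "real (pf_r m) * (real m * pf_omega m * d) ^ 2 \<le> 1"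
  shows "pf_mass m \<ge> exp (- 2) / 2 * d"
proof -
  have w: "\<bar>pf_weight m u\<bar> \<le> 1" for u
    using pf_weight_nonneg[OF m, of u] pf_weight_le_1[OF m, of u] by simp
  have "set_integrable lborel {0..} (\<lambda>t. exp (- t) * pf_weight m (t - 1))"
    by (rule set_integrable_exp_times_quadratic[where K = 1])
       (use w in \<open>auto intro: add_increasing2\<close>)
  then have i: "integrable lborel (\<lambda>t. indicator {0..} t *\<^sub>R (exp (- t) * pf_weight m (t - 1)))"
    by (simp add: set_integrable_def)
  have "(LBINT t. exp (- 2) / 2 * indicator {1..1 + d} t) \<le> pf_mass m"
    unfolding pf_mass_def set_lebesgue_integral_def
  proof (rule integral_mono[OF _ i])
    show "integrable lborel (\<lambda>t. exp (- 2) / 2 * indicator {1..1 + d} t :: real)"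
      by (intro integrable_mult_right integrable_real_indicator) (auto simp: emeasure_lborel_Icc_eq)
    fix t :: real
    show "exp (- 2) / 2 * indicator {1..1 + d} t \<le> indicator {0..} t *\<^sub>R (exp (- t) * pf_weight m (t - 1))"
    proof (cases "t \<in> {1..1 + d}")
      case True
      have "(real m * pf_omega m * (t - 1)) ^ 2 \<le> (real m * pf_omega m * d) ^ 2"
        unfolding power_mult_distrib[of _ "t - 1"] power_mult_distrib[of _ d]
        using True by (intro mult_left_mono power_mono) auto
      then have "real (pf_r m) * (real m * pf_omega m * (t - 1)) ^ 2 \<le> 1"
        using d(3) by (meson mult_left_mono of_nat_0_le_iff order_trans)
      then have "1 / 2 \<le> pf_weight m (t - 1)" by (rule pf_weight_ge_half[OF m r])
      moreover have "exp (- 2) \<le> exp (- t)" using True d by simp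
      ultimately have "exp (- 2) * (1 / 2) \<le> exp (- t) * pf_weight m (t - 1)"
        by (intro mult_mono) auto
      with True show ?thesis by simp
    next
      case False
      then show ?thesis using pf_weight_nonneg[OF m] by (auto simp: indicator_def)
    qed
  qed
  then show ?thesis using d by simp
qed

lemma pf_moment_le:
  assumes m: "m \<ge> 2" and r: "3 \<le> pf_r m" and h: "pf_h m \<ge> 2"
    and b: "b = real (pf_r m) * (real m * pf_omega m) ^ 2 / 1000" "exp (pf_h m / 2) \<le> b"
  shows "pf_moment m \<le> pi / sqrt b * (2 / b + 6 * pf_h m ^ 2 * exp (- pf_h m))"
proof -
  let ?h = "pf_h m" and ?w = "pf_weight m"
  have w: "\<bar>?w u\<bar> \<le> 1" for u
    using pf_weight_nonneg[OF m, of u] pf_weight_le_1[OF m, of u] by simp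
  have w2: "\<bar>u ^ 2 * ?w u\<bar> \<le> 1 * (1 + u ^ 2)" for u
    using mult_left_mono[OF w[of u], of "u ^ 2"] by (simp add: abs_mult)
  have peak: "?w u \<le> 1 / (1 + b * u ^ 2) ^ 3" if "\<bar>u\<bar> \<le> ?h / 2" for u
    unfolding b(1) by (rule pf_weight_peak[OF m r that]) (use h in simp)
  have i: "set_integrable lborel {a..} (\<lambda>u. exp (- u) * (u ^ 2 * ?w u))" for a
    by (rule set_integrable_exp_times_quadratic[OF _ w2]) simp
  \<comment> \<open>The substitution \<open>u = t - 1\<close> moves the peak to the origin;
    \<open>t + - 1\<close> is the form \<open>set_integral_shift_real\<close> expects.\<close>
  have "exp (- t) * ((t - 1) ^ 2 * ?w (t - 1))
      = exp (- 1) * (exp (- (t + - 1)) * ((t + - 1) ^ 2 * ?w (t + - 1)))" for t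
    unfolding mult.assoc[symmetric] exp_add[symmetric] by simp
  then have "pf_moment m = (LBINT t:{0..}. exp (- 1) * (exp (- (t + - 1)) * ((t + - 1) ^ 2 * ?w (t + - 1))))"
    unfolding pf_moment_def by (simp only:)
  also have "\<dots> = exp (- 1) * (LBINT t:{0..}. exp (- (t + - 1)) * ((t + - 1) ^ 2 * ?w (t + - 1)))"
    by (rule set_integral_mult_right)
  also have "\<dots> = exp (- 1) * (LBINT u:{-1..}. exp (- u) * (u ^ 2 * ?w u))"
    by (subst set_integral_shift_real[of 0 "\<lambda>u. exp (- u) * (u ^ 2 * ?w u)" "-1"]) simp
  finally have e1: "pf_moment m = exp (- 1) * (LBINT u:{-1..}. exp (- u) * (u ^ 2 * ?w u))" .
  \<comment> \<open>The half-line is enlarged to start at \<open>- h / 2\<close>, possible since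
    \<open>h \<ge> 2\<close>, so that its first window is one full period centred at the
    peak.\<close>
  have "(LBINT u:{-1..}. exp (- u) * (u ^ 2 * ?w u)) \<le> (LBINT u:{- (?h / 2)..}. exp (- u) * (u ^ 2 * ?w u))"
    unfolding set_lebesgue_integral_def
    by (rule integral_mono) (use i h pf_weight_nonneg[OF m] in \<open>auto simp: set_integrable_def indicator_def\<close>)
  also have "\<dots> \<le> 2 * (LBINT u:{- (?h / 2)..<- (?h / 2) + ?h}. exp (- u) * (u ^ 2 * ?w u))
        + 6 * ?h ^ 2 * exp (- ?h) * (LBINT u:{- (?h / 2)..<- (?h / 2) + ?h}. exp (- u) * ?w u)"
  proof (rule periodic_weight_second_moment)
    have "4 \<le> exp (2::real)" using exp_lower_Taylor_quadratic[of 2] by simp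
    also have "exp 2 \<le> exp ?h" using h by simp
    finally have "4 \<le> exp ?h" .
    then show "exp (- ?h) \<le> 1 / 4" by (simp add: exp_minus field_simps)
  qed (use m h pf_weight_nonneg pf_weight_le_1 in \<open>auto intro!: pf_weight_periodic\<close>)
  also have "- (?h / 2) + ?h = ?h / 2" by simp
  also have "2 * (LBINT u:{- (?h / 2)..<?h / 2}. exp (- u) * (u ^ 2 * ?w u))
        + 6 * ?h ^ 2 * exp (- ?h) * (LBINT u:{- (?h / 2)..<?h / 2}. exp (- u) * ?w u)
      \<le> 2 * (exp 1 * pi / (b * sqrt b)) + 6 * ?h ^ 2 * exp (- ?h) * (exp 1 * pi / sqrt b)"
    using peak h b(2) pf_weight_nonneg[OF m]
    by (intro add_mono mult_left_mono peak_moments) auto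
  finally have "pf_moment m \<le> exp (- 1) * (2 * (exp 1 * pi / (b * sqrt b)) + 6 * ?h ^ 2 * exp (- ?h) * (exp 1 * pi / sqrt b))"
    unfolding e1 by (rule mult_left_mono) simp
  also have "\<dots> = (exp (- 1) * exp 1) * (pi / sqrt b * (2 / b + 6 * ?h ^ 2 * exp (- ?h)))"
    by (simp only: distrib_left times_divide_eq_left times_divide_eq_right) (simp add: mult_ac)
  also have "exp (- 1) * exp 1 = (1::real)" by (simp add: exp_minus)
  finally show ?thesis by simp
qed

subsection \<open>Asymptotics\<close>

lemma pf_mass_eventually_ge:
  "\<forall>\<^sub>F m in sequentially. exp (- 2) / 10 * (sqrt (ln (real m)) / real m) \<le> pf_mass m"
  using pf_eventually_bounds
proof eventually_elim
  case (elim m)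
  \<comment> \<open>\<open>d\<close> is of the order of the peak width; the divisor \<open>5\<close>
    gives \<open>r * (m * omega * d) ^ 2 \<le> 2 * pi ^ 2 / 25 < 1\<close>.\<close>
  define L d where "L = ln (real m)" and "d = sqrt L / (5 * real m)"
  have m: "m \<ge> 2" "real m > 0" and r: "3 \<le> pf_r m" "real (pf_r m) \<le> 2 * L" and h: "2 * L \<le> pf_h m"
    and L: "L \<ge> 1"
    using elim by (auto simp: L_def)
  have "exp (- 2) / 2 * d \<le> pf_mass m"
  proof (rule pf_mass_ge[OF m(1) r(1)])
    show "0 \<le> d" using L by (simp add: d_def)
    have "L \<le> real m" using ln_le_minus_one[of "real m"] m by (simp add: L_def)
    moreover have "sqrt L \<le> L"
      using L by (intro real_le_lsqrt) (auto simp: power2_eq_square)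
    ultimately show "d \<le> 1" using m by (simp add: d_def field_simps)
    have om: "0 \<le> pf_omega m" "pf_omega m \<le> pi / L"
      using h L by (auto simp: pf_omega_def field_simps)
    have "(real m * pf_omega m * d) ^ 2 = pf_omega m ^ 2 * (L / 25)"
      using m L by (simp add: d_def field_simps power2_eq_square)
    also have "\<dots> \<le> (pi / L) ^ 2 * (L / 25)"
      using om L by (intro mult_right_mono power_mono) auto
    finally have "real (pf_r m) * (real m * pf_omega m * d) ^ 2 \<le> (2 * L) * ((pi / L) ^ 2 * (L / 25))"
      using r L by (intro mult_mono) auto
    also have "\<dots> = 2 * pi ^ 2 / 25" using L by (simp add: power2_eq_square)
    also have "\<dots> \<le> 1"
      using power_mono[of pi "3.2" 2] pi_approx by (simp add: power2_eq_square)
    finally show "real (pf_r m) * (real m * pf_omega m * d) ^ 2 \<le> 1" .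
  qed
  then show ?case by (simp add: d_def L_def)
qed

lemma pf_moment_eventually_le:
  "\<forall>\<^sub>F m in sequentially. pf_moment m \<le> 8864 * pi * (sqrt (ln (real m)) / real m) * (ln (real m) / real m ^ 2)"
  using pf_eventually_bounds
proof eventually_elim
  case (elim m)
  define L b where "L = ln (real m)" and "b = real (pf_r m) * (real m * pf_omega m) ^ 2 / 1000"
  have m: "m \<ge> 2" "real m > 0" and r: "3 \<le> pf_r m" "L \<le> real (pf_r m)" and h: "2 * L \<le> pf_h m" "pf_h m \<le> 3 * L"
    and L: "L \<ge> 1" and exp_le: "real m * sqrt L \<le> real m ^ 2 / (250 * L)"
    using elim by (auto simp: L_def)
  \<comment> \<open>From \<open>r \<ge> L\<close> and
    \<open>omega \<ge> 2 * pi / (3 * L) \<ge> 2 / L\<close>; this makes \<open>b\<close> at least of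
    order \<open>m ^ 2 / L\<close>.\<close>
  have "L * (real m * (2 / L)) ^ 2 / 1000 \<le> b"
    unfolding b_def
  proof (intro divide_right_mono mult_mono power_mono mult_left_mono)
    have "2 / L \<le> 2 * pi / (3 * L)" using L pi_gt3 by (simp add: field_simps)
    also have "\<dots> \<le> pf_omega m"
      using L h unfolding pf_omega_def by (intro divide_left_mono) auto
    finally show "2 / L \<le> pf_omega m" .
  qed (use L r in auto)
  then have b: "real m ^ 2 / (250 * L) \<le> b"
    using L by (simp add: power_mult_distrib power_divide power2_eq_square)
  have b0: "real m ^ 2 / (250 * L) > 0" using m L by simp
  have mom: "pf_moment m \<le> pi / sqrt b * (2 / b + 6 * pf_h m ^ 2 * exp (- pf_h m))"
  proof (rule pf_moment_le[OF m(1) r(1) _ b_def])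
    show "2 \<le> pf_h m" using h L by simp
    show "exp (pf_h m / 2) \<le> b"
      using pf_h_exp(2)[of m] m L exp_le b by (simp add: L_def)
  qed
  have "2 / b \<le> 2 / (real m ^ 2 / (250 * L))"
    using b b0 by (intro divide_left_mono mult_pos_pos) auto
  then have t1: "2 / b \<le> 500 * (L / real m ^ 2)" by simp
  have "pf_h m ^ 2 \<le> (3 * L) ^ 2" using h L by (intro power_mono) auto
  then have "6 * pf_h m ^ 2 * exp (- pf_h m) \<le> 6 * (3 * L) ^ 2 * exp (- pf_h m)"
    by (intro mult_right_mono mult_left_mono) auto
  also have "\<dots> = 54 * (L / real m ^ 2)"
    using pf_h_exp(1)[of m] m L by (simp add: L_def power2_eq_square)
  \<comment> \<open>\<open>500\<close> comes from the first period and \<open>54\<close> from the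
    later ones: the choice of \<open>h\<close> gives both the same order.\<close>
  finally have t: "2 / b + 6 * pf_h m ^ 2 * exp (- pf_h m) \<le> 554 * (L / real m ^ 2)"
    using t1 by simp
  \<comment> \<open>\<open>16 ^ 2 = 256 \<ge> 250\<close>, and \<open>16 * 554 = 8864\<close> gives
    the final constant.\<close>
  have "(real m / (16 * sqrt L)) ^ 2 \<le> real m ^ 2 / (250 * L)"
    using L m by (simp add: power_mult_distrib power_divide field_simps)
  with b have "real m / (16 * sqrt L) \<le> sqrt b"
    by (intro real_le_rsqrt) simp
  moreover have bpos: "b > 0" using b b0 by linarith
  ultimately have "pi / sqrt b \<le> pi / (real m / (16 * sqrt L))"
    using m L by (intro divide_left_mono mult_pos_pos) auto
  then have "pi / sqrt b * (2 / b + 6 * pf_h m ^ 2 * exp (- pf_h m))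
      \<le> pi / (real m / (16 * sqrt L)) * (554 * (L / real m ^ 2))"
    using t m L bpos by (intro mult_mono) auto
  also have "\<dots> = 8864 * pi * (sqrt L / real m) * (L / real m ^ 2)" by simp
  finally show ?case using mom by (simp add: L_def)
qed

section \<open>From mass and moment to the squared coefficient of variation\<close>

lemma pf_cme_variance_expectation:
  fixes X :: "'a \<Rightarrow> real"
  assumes m: "m \<ge> 2" and M: "prob_space M"
    and X: "distributed M lborel X (\<lambda>t. ennreal (pf_cme_density m t))"
  shows "pf_mass m ^ 2 / 32 \<le> prob_space.variance M X"
    and "prob_space.variance M X + (prob_space.expectation M X - 1) ^ 2 = pf_moment m / pf_mass m"
    and "prob_space.expectation M X > 0"
proof -
  interpret prob_space M by fact
  note mom = pf_cme_moments[OF m X]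
  have i: "integrable M X" "integrable M (\<lambda>x. X x ^ 2)" using mom M by auto
  note f0 = pf_cme_density_nonneg[OF m]
  have "1 / (32 * (1 / pf_mass m) ^ 2) \<le> variance X"
    by (rule variance_ge_of_density_le[OF M X f0 pf_cme_density_le[OF m] _ i])
       (use pf_mass_pos[OF m] in auto)
  then show V: "pf_mass m ^ 2 / 32 \<le> variance X" by (simp add: power_divide)
  have "(LINT x|M. (X x - 1) ^ 2) = expectation (\<lambda>x. (X x) ^ 2) - 2 * expectation X + 1"
    using i by (simp add: power2_diff prob_space)
  then show "variance X + (expectation X - 1) ^ 2 = pf_moment m / pf_mass m"
    unfolding mom(3)[symmetric] variance_eq[OF i] by (simp add: power2_diff)
  have nn: "0 \<le> pf_cme_density m t * t" for t
    using f0[of t] by (cases "t \<ge> 0") (auto simp: pf_cme_density_def)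
  have E: "(LBINT t. pf_cme_density m t * t) = expectation X"
    using distributed_integral[OF X, of "\<lambda>t. t"] f0 by simp
  have "integrable lborel (\<lambda>t. pf_cme_density m t * t)"
    using distributed_integrable[OF X, of "\<lambda>t. t"] f0 i by simp
  then have iff: "expectation X = 0 \<longleftrightarrow> (AE t in lborel. pf_cme_density m t * t = 0)"
    unfolding E[symmetric] by (rule integral_nonneg_eq_0_iff_AE) (use nn in auto)
  \<comment> \<open>The law lives on the half-line, so mean zero would force \<open>X = 0\<close>
    almost surely, contradicting the positive variance bound.\<close>
  have "expectation X \<noteq> 0"
  proof
    assume z: "expectation X = 0"
    with iff have "AE t in lborel. pf_cme_density m t * t = 0" by simp
    then have "AE t in lborel. pf_cme_density m t * t ^ 2 = 0" by eventually_elim auto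
    then have "(LBINT t. pf_cme_density m t * t ^ 2) = 0" by (rule integral_eq_zero_AE)
    then have "expectation (\<lambda>x. X x ^ 2) = 0"
      using distributed_integral[OF X, of "\<lambda>t. t ^ 2"] f0 by simp
    then have "variance X = 0" using z by simp
    with V have "pf_mass m ^ 2 \<le> 0" by simp
    with pf_mass_pos[OF m] show False by simp
  qed
  moreover have "expectation X \<ge> 0" unfolding E[symmetric] using nn by simp
  ultimately show "expectation X > 0" by simp
qed

lemma pf_cme_SCV_pos:
  assumes m: "m \<ge> 2" and M: "prob_space M"
    and X: "distributed M lborel X (\<lambda>t. ennreal (pf_cme_density m t))"
  shows "SCV M X > 0"
proof -
  have "0 < pf_mass m ^ 2 / 32" using pf_mass_pos[OF m] by simp
  with pf_cme_variance_expectation(1)[OF m M X] have "prob_space.variance M X > 0" by linarith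
  with pf_cme_variance_expectation(3)[OF m M X] show ?thesis unfolding SCV_def by simp
qed

text \<open>The squared bias \<open>(E - 1) ^ 2\<close> is part of the second moment about
  \<open>1\<close>, so a small moment keeps the mean in \<open>[1 / 2, 2]\<close>; dividing by its
  square then costs at most a factor \<open>4\<close> either way.\<close>

lemma pf_cme_SCV_bounds:
  assumes m: "m \<ge> 2" and M: "prob_space M"
    and X: "distributed M lborel X (\<lambda>t. ennreal (pf_cme_density m t))"
    and small: "pf_moment m / pf_mass m \<le> 1 / 4"
  shows "pf_mass m ^ 2 / 128 \<le> SCV M X" and "SCV M X \<le> 4 * (pf_moment m / pf_mass m)"
proof -
  interpret prob_space M by fact
  define E V S where "E = expectation X" and "V = variance X" and "S = pf_moment m / pf_mass m"
  have V: "pf_mass m ^ 2 / 32 \<le> V" "V + (E - 1) ^ 2 = S"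
    using pf_cme_variance_expectation[OF m M X] by (auto simp: E_def V_def S_def)
  have V0: "V \<ge> 0" using V(1) zero_le_power2[of "pf_mass m"] by linarith
  have "(E - 1) ^ 2 \<le> 1 / 4" using V(2) V0 small unfolding S_def by linarith
  then have "\<bar>E - 1\<bar> \<le> 1 / 2"
    using abs_le_square_iff[of "E - 1" "1 / 2"] by (simp add: power2_eq_square)
  then have "1 / 2 \<le> E" "E \<le> 2" by linarith+
  then have E2: "1 / 4 \<le> E ^ 2" "E ^ 2 \<le> 4"
    using power_mono[of "1/2" E 2] power_mono[of E 2 2] by (auto simp: power2_eq_square)
  have "V / E ^ 2 \<le> S / (1 / 4)"
    using E2 V0 V(2) zero_le_power2[of "E - 1"] by (intro frac_le) auto
  then show "SCV M X \<le> 4 * (pf_moment m / pf_mass m)"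
    by (simp add: SCV_def E_def V_def S_def mult.commute)
  have "pf_mass m ^ 2 / 32 / 4 \<le> V / E ^ 2"
    using E2 V0 V(1) by (intro frac_le) auto
  then show "pf_mass m ^ 2 / 128 \<le> SCV M X"
    by (simp add: SCV_def E_def V_def)
qed

text \<open>The finitely many early terms are positive and enter through a minimum and a maximum;
  inserting \<open>c\<close> and \<open>C\<close> keeps both sets nonempty.\<close>

lemma bounds_from_eventual_bounds:
  fixes g :: "nat \<Rightarrow> real"
  assumes pos: "\<And>m. m \<ge> k \<Longrightarrow> g m > 0" and ev: "\<forall>\<^sub>F m in sequentially. c \<le> g m \<and> g m \<le> C" and c: "c > 0"
  shows "\<exists>c C. 0 < c \<and> (\<forall>m\<ge>k. c \<le> g m \<and> g m \<le> C)"
proof -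
  obtain N where N: "\<And>m. m \<ge> N \<Longrightarrow> c \<le> g m \<and> g m \<le> C"
    using ev by (auto simp: eventually_sequentially)
  let ?c = "Min (insert c (g ` {k..<N}))" and ?C = "Max (insert C (g ` {k..<N}))"
  have "?c > 0" using c pos by auto
  moreover have "?c \<le> g m \<and> g m \<le> ?C" if "m \<ge> k" for m
  proof (cases "m < N")
    case True
    with that have "g m \<in> g ` {k..<N}" by auto
    then show ?thesis by (auto intro!: Min_le Max_ge)
  next
    case False
    have "?c \<le> c" "C \<le> ?C" by (auto intro!: Min_le Max_ge)
    with False N[of m] show ?thesis by linarith
  qed
  ultimately show ?thesis by blast
qed

section \<open>Growth of the order \<open>pf_n\<close>\<close>

lemma pf_n_eventually_bounds:
  "\<forall>\<^sub>F m in sequentially. m \<ge> 3 \<and> 1 \<le> ln (real m) \<and> ln (real m) * real m \<le> real (pf_n m) \<and> real (pf_n m) \<le> 5 * ln (real m) * real m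
      \<and> ln (real m) \<le> ln (real (pf_n m)) \<and> ln (real (pf_n m)) \<le> 3 * ln (real m)"
proof -
  have "\<forall>\<^sub>F m in sequentially. 5 * ln (real m) * real m \<le> real m ^ 3" by real_asymp
  then show ?thesis
    using pf_eventually_bounds eventually_ge_at_top[of 3]
  proof eventually_elim
    case (elim m)
    define L r where "L = ln (real m)" and "r = real (pf_r m)"
    have L: "1 \<le> L" "L \<le> r" "r \<le> 2 * L" and m: "m \<ge> 3" using elim by (auto simp: L_def r_def)
    have n: "real (pf_n m) = 2 * r * (real m - 1) + 1"
      using m by (simp add: pf_n_def r_def of_nat_diff)
    have "L * (2 * (real m - 1)) \<le> r * (2 * (real m - 1))" using L m by (intro mult_right_mono) auto
    moreover have "L * real m \<le> L * (2 * (real m - 1))" using L m by (intro mult_left_mono) auto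
    ultimately have n1: "L * real m \<le> real (pf_n m)" unfolding n by (simp add: algebra_simps)
    have "r * (2 * (real m - 1)) \<le> 2 * L * (2 * (real m - 1))" using L m by (intro mult_right_mono) auto
    moreover have "1 * 1 \<le> L * real m" using L m by (intro mult_mono) auto
    ultimately have n2: "real (pf_n m) \<le> 5 * L * real m" unfolding n using L by (simp add: algebra_simps)
    have "1 * real m \<le> L * real m" using L m by (intro mult_right_mono) auto
    with n1 have mn: "real m \<le> real (pf_n m)" by simp
    then have l1: "L \<le> ln (real (pf_n m))" using m unfolding L_def by (subst ln_le_cancel_iff) auto
    have "real (pf_n m) \<le> real m ^ 3" using n2 elim(1) unfolding L_def by (rule order_trans)
    then have "ln (real (pf_n m)) \<le> ln (real m ^ 3)"
      using mn m by (subst ln_le_cancel_iff) auto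
    then have l2: "ln (real (pf_n m)) \<le> 3 * L" using m by (simp add: L_def ln_realpow)
    show ?case using L m n1 n2 l1 l2 by (simp add: L_def)
  qed
qed

text \<open>With \<open>n\<close> between \<open>L * m\<close> and \<open>5 * L * m\<close> and
  \<open>ln n\<close> between \<open>L\<close> and \<open>3 * L\<close>, the two rates agree up to
  constants, so the second bounded sequence reduces to the first.\<close>

lemma pf_n_rate_eventually:
  "\<forall>\<^sub>F m in sequentially. 1 / 27 * (real m ^ 2 / ln (real m)) \<le> real (pf_n m) ^ 2 / ln (real (pf_n m)) ^ 3
     \<and> real (pf_n m) ^ 2 / ln (real (pf_n m)) ^ 3 \<le> 25 * (real m ^ 2 / ln (real m))"
  using pf_n_eventually_bounds
proof eventually_elim
  case (elim m)
  define L n where "L = ln (real m)" and "n = real (pf_n m)"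
  have L: "L \<ge> 1" and m: "real m > 0" and n: "L * real m \<le> n" "n \<le> 5 * L * real m"
    and ln: "L \<le> ln n" "ln n \<le> 3 * L"
    using elim by (auto simp: L_def n_def)
  have n0: "0 \<le> n" by (simp add: n_def)
  have "(L * real m) ^ 2 / (3 * L) ^ 3 \<le> n ^ 2 / ln n ^ 3"
    using L m n ln by (intro frac_le power_mono zero_less_power) auto
  moreover have "n ^ 2 / ln n ^ 3 \<le> (5 * L * real m) ^ 2 / L ^ 3"
    using L m n n0 ln by (intro frac_le power_mono zero_less_power) auto
  ultimately show ?case
    using L unfolding L_def[symmetric] n_def[symmetric]
    by (simp add: power_mult_distrib power2_eq_square power3_eq_cube)
qed

theorem corollary7:
  fixes M :: "nat \<Rightarrow> 'a measure" and X :: "nat \<Rightarrow> 'a \<Rightarrow> real"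
  assumes prob: "\<And>m. m \<ge> 2 \<Longrightarrow> prob_space (M m)"
    and dens: "\<And>m. m \<ge> 2 \<Longrightarrow> distributed (M m) lborel (X m) (\<lambda>t. ennreal (pf_cme_density m t))"
  shows "(\<lambda>m. ln (real (pf_n m)) ^ 3 / real (pf_n m) ^ 2) \<in> o(\<lambda>m. 1 / real (pf_n m))
    \<and> (\<forall>\<^sub>F m in sequentially. SCV (M m) (X m) < 1 / real (pf_n m))
    \<and> (\<exists>c C. 0 < c \<and> (\<forall>m\<ge>2. c \<le> real m ^ 2 / ln (real m) * SCV (M m) (X m)
          \<and> real m ^ 2 / ln (real m) * SCV (M m) (X m) \<le> C))
    \<and> (\<exists>c C. 0 < c \<and> (\<forall>m\<ge>2. c \<le> real (pf_n m) ^ 2 / ln (real (pf_n m)) ^ 3 * SCV (M m) (X m)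
          \<and> real (pf_n m) ^ 2 / ln (real (pf_n m)) ^ 3 * SCV (M m) (X m) \<le> C))"
proof (intro conjI)
  let ?S = "\<lambda>m. SCV (M m) (X m)"
  have pos: "?S m > 0" if "m \<ge> 2" for m
    by (rule pf_cme_SCV_pos[OF that prob[OF that] dens[OF that]])
  \<comment> \<open>\<open>k\<close> is the constant in the lower bound for the mass, and
    \<open>K\<close> bounds the ratio of moment to mass in units of
    \<open>ln m / m ^ 2\<close>.\<close>
  define k K where "k = exp (- 2) / (10::real)" and "K = 8864 * pi / k"
  have k: "k > 0" and K: "K > 0" by (simp_all add: k_def K_def)
  define c where "c = k ^ 2 / 128"
  have c: "c > 0" using k by (simp add: c_def)
  have "\<forall>\<^sub>F m in sequentially. K * (ln (real m) / real m ^ 2) \<le> 1 / 4"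
    using K by real_asymp
  then have ev: "\<forall>\<^sub>F m in sequentially. c \<le> real m ^ 2 / ln (real m) * ?S m
      \<and> real m ^ 2 / ln (real m) * ?S m \<le> 4 * K"
    using pf_mass_eventually_ge pf_moment_eventually_le pf_eventually_bounds
  proof eventually_elim
    case (elim m)
    \<comment> \<open>\<open>s\<close> is the scale of the peak width: the mass is at least
      \<open>k * s\<close> and the normalised moment at most \<open>K * s ^ 2\<close>.\<close>
    define L s where "L = ln (real m)" and "s = sqrt L / real m"
    have m: "m \<ge> 2" and L: "L \<ge> 1" using elim by (auto simp: L_def)
    have s: "s > 0" "s ^ 2 = L / real m ^ 2" using m L by (auto simp: s_def power_divide)
    have mass: "k * s \<le> pf_mass m" and mom: "pf_moment m \<le> 8864 * pi * s * s ^ 2"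
      using elim unfolding s(2) by (auto simp: s_def L_def k_def)
    have "pf_moment m / pf_mass m \<le> (8864 * pi * s * s ^ 2) / (k * s)"
      using mass mom s(1) k by (intro frac_le) auto
    also have "\<dots> = K * s ^ 2" using s(1) by (simp add: K_def)
    finally have R: "pf_moment m / pf_mass m \<le> K * s ^ 2" .
    also have "\<dots> \<le> 1 / 4" using elim(1) unfolding s(2) by (simp add: L_def)
    finally have small: "pf_moment m / pf_mass m \<le> 1 / 4" .
    note B = pf_cme_SCV_bounds[OF m prob[OF m] dens[OF m] small]
    have "(k * s) ^ 2 \<le> pf_mass m ^ 2" using mass k s by (intro power_mono) auto
    with B(1) have "c * s ^ 2 \<le> ?S m" by (simp add: c_def power_mult_distrib)
    moreover have "?S m \<le> 4 * K * s ^ 2" using B(2) R by simp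
    ultimately show ?case
      using L m unfolding s(2) L_def[symmetric] by (simp add: field_simps)
  qed
  show "\<exists>c C. 0 < c \<and> (\<forall>m\<ge>2. c \<le> real m ^ 2 / ln (real m) * ?S m \<and> real m ^ 2 / ln (real m) * ?S m \<le> C)"
    by (rule bounds_from_eventual_bounds[OF _ ev c]) (use pos in auto)
  have "\<forall>\<^sub>F m in sequentially. c / 27 \<le> real (pf_n m) ^ 2 / ln (real (pf_n m)) ^ 3 * ?S m
      \<and> real (pf_n m) ^ 2 / ln (real (pf_n m)) ^ 3 * ?S m \<le> 100 * K"
    using ev pf_n_rate_eventually eventually_ge_at_top[of 2]
  proof eventually_elim
    case (elim m)
    define p q where "p = real m ^ 2 / ln (real m)" and "q = real (pf_n m) ^ 2 / ln (real (pf_n m)) ^ 3"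
    have S: "?S m \<ge> 0" using pos[OF elim(3)] by simp
    have pq: "1 / 27 * p \<le> q" "q \<le> 25 * p" using elim(2) by (auto simp: p_def q_def)
    have "1 / 27 * p * ?S m \<le> q * ?S m" "q * ?S m \<le> 25 * p * ?S m"
      using pq S by (auto intro!: mult_right_mono simp del: times_divide_eq_left)
    with elim(1) show ?case unfolding p_def[symmetric] q_def[symmetric] by simp
  qed
  then show "\<exists>c C. 0 < c \<and> (\<forall>m\<ge>2. c \<le> real (pf_n m) ^ 2 / ln (real (pf_n m)) ^ 3 * ?S m
      \<and> real (pf_n m) ^ 2 / ln (real (pf_n m)) ^ 3 * ?S m \<le> C)"
  proof (rule bounds_from_eventual_bounds[rotated])
    fix m :: nat assume m: "m \<ge> 2"
    \<comment> \<open>Already at \<open>m = 2\<close> this gives \<open>pf_n m > 1\<close>, hence a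
      positive logarithm in the denominator.\<close>
    then have "pf_r m \<ge> 1" by (simp add: pf_r_def Suc_le_eq)
    then have "pf_n m > 1" using m by (simp add: pf_n_def)
    then show "real (pf_n m) ^ 2 / ln (real (pf_n m)) ^ 3 * ?S m > 0"
      using pos[OF m] by (intro mult_pos_pos divide_pos_pos zero_less_power) auto
  qed (use c in auto)
  \<comment> \<open>Compares the upper bound \<open>4 * K * L / m ^ 2\<close> with
    \<open>1 / (5 * L * m) \<le> 1 / n\<close>, which amounts to
    \<open>20 * K * L ^ 2 < m\<close>.\<close>
  have "\<forall>\<^sub>F m in sequentially. 20 * K * ln (real m) ^ 2 < real m"
    using K by real_asymp
  with ev pf_n_eventually_bounds show "\<forall>\<^sub>F m in sequentially. ?S m < 1 / real (pf_n m)"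
  proof eventually_elim
    case (elim m)
    define L where "L = ln (real m)"
    have L: "L \<ge> 1" and m: "real m > 0" and n: "L * real m \<le> real (pf_n m)" "real (pf_n m) \<le> 5 * L * real m"
      and K': "20 * K * L ^ 2 < real m"
      using elim by (auto simp: L_def)
    have "?S m \<le> 4 * K * L / real m ^ 2"
      using elim(1) L m unfolding L_def[symmetric] by (simp add: field_simps)
    also have "\<dots> < 1 / (5 * L * real m)"
      using K' L m by (simp add: field_simps power2_eq_square)
    also have "\<dots> \<le> 1 / real (pf_n m)"
    proof -
      have "0 < L * real m" using L m by simp
      with n have "0 < real (pf_n m)" by linarith
      with n L m show ?thesis by (intro divide_left_mono mult_pos_pos) auto
    qed
    finally show ?case .
  qed
  \<comment> \<open>The little-o relation is proved for a real variable and then composed with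
    \<open>pf_n\<close>, which tends to infinity.\<close>
  have "filterlim (\<lambda>m. real (pf_n m)) at_top sequentially"
  proof (rule filterlim_at_top_mono[OF filterlim_real_sequentially])
    show "\<forall>\<^sub>F m in sequentially. real m \<le> real (pf_n m)"
      using pf_n_eventually_bounds
    proof eventually_elim
      case (elim m)
      then have "1 * real m \<le> ln (real m) * real m" by (intro mult_right_mono) auto
      with elim show ?case by linarith
    qed
  qed
  moreover have "(\<lambda>x. ln x ^ 3 / x ^ 2) \<in> o[at_top](\<lambda>x::real. 1 / x)" by real_asymp
  ultimately show "(\<lambda>m. ln (real (pf_n m)) ^ 3 / real (pf_n m) ^ 2) \<in> o(\<lambda>m. 1 / real (pf_n m))"
    by (rule landau_o.small.compose[rotated])
qed

end
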